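(* Let $X\subseteq\mathbb{R}^2$ be a non-empty open set, let $f,g:X\to\mathbb{R}^2$ be continuous with $f(x)\neq g(x)$ for all $x\in X$, and let $F(x)=\{f(x),g(x)\}$ for $x\in X$. Let $x^*\in X$ with $f(x^* )=0$ and $g(x^* )\neq 0$. Let $\lambda_1,\lambda_2$ be the eigenvalues of the Jacobi matrix of $f$ at $x^*$ and let $e_1,e_2$ be corresponding eigenvectors. Let $\delta>0$ be such that $g(x)\neq 0$ for every $x\in\bar B_\delta(x^* )$ and such that the solution of $\dot x=g(x)$ is unbounded in $\bar B_\delta(x^* )$. Assume $\lambda_1<0$ and $\lambda_2>0$ (i.e. $x^*$ is a saddle point of $\dot x=f(x)$), and assume that $g(x^* )=\alpha e_1$ or $g(x^* )=\beta e_2$ for some $\alpha,\beta\in\mathbb{R}\setminus\{0\}$. Then $F$ admits a chaotic set, i.e. there exists a chaotic set $V\subset X$ for $F$.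
   Context: $\mathbb{R}^2$ carries the Euclidean metric; $\bar B_\delta(x^* )\subset X$ is the closed ball of radius $\delta$ about $x^*$; $T=[0,\infty)$. The Jacobi matrix of $f$ at $x^*$ is assumed to exist, and $f$ and $g$ are assumed to generate flows. "The solution of $\dot x=g(x)$ is unbounded in $\bar B_\delta(x^* )$" means that every solution of $\dot x=g(x)$ through a point of $\bar B_\delta(x^* )$ leaves $\bar B_\delta(x^* )$ (in forward and in backward time). Let $Z$ be the set of functions $\gamma:T\to X$ that are continuous and continuously differentiable almost everywhere. The dynamical system generated by $F$ is $D=\{\gamma\in Z : \dot\gamma(t)\in F(\gamma(t)) \text{ for a.e. } t\}$. A non-empty set $V$ is compact $F$-invariant if $V$ is compact and for each $x\in V$ there is $\gamma\in D$ with $\gamma(0)=x$ and $\gamma(t)\in V$ for all $t\in T$. For such $V$ put $V^*=\{\gamma\in D:\gamma(t)\in V\text{ for all }t\in T\}$. For $a,b\in X$ and a set $E\subseteq D$, a simple path from $a$ to $b$ generated by $E$ is a set $P=\{\gamma(t):t_0\le t\le t_1\}$ with $\gamma\in E$, $t_0<t_1$ in $T$, $\gamma(t_0)=a$, $\gamma(t_1)=b$, $\dot\gamma$ having finitely many discontinuities on $[t_0,t_1]$, and $a\neq\gamma(s)\neq b$ for all $t_0<s<t_1$. A non-empty compact $F$-invariant set $V\subset X$ is a chaotic set if (1) for all $a,b\in V$ there exists a simple path from $a$ to $b$ generated by $V^*$; and (2) there exist a non-empty set $U\subset V$, open relative to $V$, and $\gamma\in V^*$ such that $\gamma(t)\in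 V\setminus U$ for all $t\in T$.
   Formalization: The existence of the Jacobi matrix of f at x* is taken to mean that f is (Fréchet) differentiable at x*; with mere existence of the partial derivatives at x* the claim can fail. *)

theory Defs
  imports "HOL-Analysis.Analysis"
begin

definition ode_solution ::
    "('a::euclidean_space \<Rightarrow> 'a) \<Rightarrow> 'a set \<Rightarrow> real set \<Rightarrow> (real \<Rightarrow> 'a) \<Rightarrow> bool" where
  "ode_solution f X I \<gamma> \<longleftrightarrow>
     is_interval I \<and> \<gamma> ` I \<subseteq> X \<and>
     (\<forall>t\<in>I. (\<gamma> has_vector_derivative f (\<gamma> t)) (at t within I))"

definition maximal_ode_solution ::
    "('a::euclidean_space \<Rightarrow> 'a) \<Rightarrow> 'a set \<Rightarrow> real set \<Rightarrow> (real \<Rightarrow> 'a) \<Rightarrow> bool" where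
  "maximal_ode_solution f X I \<gamma> \<longleftrightarrow>
     ode_solution f X I \<gamma> \<and>
     (\<forall>I' \<gamma>'. ode_solution f X I' \<gamma>' \<and> I \<subseteq> I' \<and> (\<forall>t\<in>I. \<gamma>' t = \<gamma> t) \<longrightarrow> I' = I)"

(* The flow is a local one: X is an arbitrary open set, so solutions may leave X in finite time.
   J x is the maximal existence interval of the solution \<phi> _ x through x. The solution through
   each point is unique; the group law follows from this. A global flow is the case J x = UNIV. *)
definition generates_flow :: "('a::euclidean_space \<Rightarrow> 'a) \<Rightarrow> 'a set \<Rightarrow> bool" where
  "generates_flow f X \<longleftrightarrow>
     (\<exists>(J :: 'a \<Rightarrow> real set) (\<phi> :: real \<Rightarrow> 'a \<Rightarrow> 'a).
        (\<forall>x\<in>X. 0 \<in> J x \<and> \<phi> 0 x = x \<and> ode_solution f X (J x) (\<lambda>t. \<phi> t x) \<and>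
           (\<forall>I \<gamma>. ode_solution f X I \<gamma> \<and> 0 \<in> I \<and> \<gamma> 0 = x \<longrightarrow>
              I \<subseteq> J x \<and> (\<forall>t\<in>I. \<gamma> t = \<phi> t x))) \<and>
        open {(t, x). x \<in> X \<and> t \<in> J x} \<and>
        continuous_on {(t, x). x \<in> X \<and> t \<in> J x} (\<lambda>(t, x). \<phi> t x))"

definition solutions_unbounded_in ::
    "('a::euclidean_space \<Rightarrow> 'a) \<Rightarrow> 'a set \<Rightarrow> 'a set \<Rightarrow> bool" where
  "solutions_unbounded_in g X B \<longleftrightarrow>
     (\<forall>I \<gamma>. maximal_ode_solution g X I \<gamma> \<longrightarrow>
        (\<forall>s\<in>I. \<gamma> s \<in> B \<longrightarrow>
           (\<exists>t\<in>I. s < t \<and> \<gamma> t \<notin> B) \<and> (\<exists>t\<in>I. t < s \<and> \<gamma> t \<notin> B)))"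

definition eigenpair :: "real^'n^'n \<Rightarrow> real \<Rightarrow> real^'n \<Rightarrow> bool" where
  "eigenpair A l v \<longleftrightarrow> v \<noteq> 0 \<and> A *v v = l *\<^sub>R v"

(* Curves are total functions on the reals of which only the restriction to {0..} matters:
   the null set N may always be taken to contain 0, where the derivative would be two-sided. *)
definition curves :: "'a::euclidean_space set \<Rightarrow> (real \<Rightarrow> 'a) set" where
  "curves X = {\<gamma>. \<gamma> ` {0..} \<subseteq> X \<and> continuous_on {0..} \<gamma> \<and>
     (\<exists>N. negligible N \<and> \<gamma> C1_differentiable_on ({0..} - N))}"

definition dyn_system ::
    "'a::euclidean_space set \<Rightarrow> ('a \<Rightarrow> 'a set) \<Rightarrow> (real \<Rightarrow> 'a) set" where
  "dyn_system X F = {\<gamma> \<in> curves X.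
     AE t in lebesgue. 0 \<le> t \<longrightarrow> vector_derivative \<gamma> (at t) \<in> F (\<gamma> t)}"

definition compact_invariant ::
    "'a::euclidean_space set \<Rightarrow> ('a \<Rightarrow> 'a set) \<Rightarrow> 'a set \<Rightarrow> bool" where
  "compact_invariant X F V \<longleftrightarrow>
     V \<noteq> {} \<and> V \<subseteq> X \<and> compact V \<and>
     (\<forall>x\<in>V. \<exists>\<gamma>\<in>dyn_system X F. \<gamma> 0 = x \<and> (\<forall>t\<ge>0. \<gamma> t \<in> V))"

definition curves_within ::
    "'a::euclidean_space set \<Rightarrow> ('a \<Rightarrow> 'a set) \<Rightarrow> 'a set \<Rightarrow> (real \<Rightarrow> 'a) set" where
  "curves_within X F V = {\<gamma> \<in> dyn_system X F. \<forall>t\<ge>0. \<gamma> t \<in> V}"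

(* Piecewise C1 means that the derivative exists and is continuous off a finite set; points
   where the derivative does not exist count among its discontinuities. *)
definition is_simple_path ::
    "(real \<Rightarrow> 'a::euclidean_space) set \<Rightarrow> 'a \<Rightarrow> 'a \<Rightarrow> 'a set \<Rightarrow> bool" where
  "is_simple_path E a b P \<longleftrightarrow>
     (\<exists>\<gamma>\<in>E. \<exists>t0 t1. 0 \<le> t0 \<and> t0 < t1 \<and> P = \<gamma> ` {t0..t1} \<and>
        \<gamma> t0 = a \<and> \<gamma> t1 = b \<and>
        \<gamma> piecewise_C1_differentiable_on {t0..t1} \<and>
        (\<forall>s. t0 < s \<and> s < t1 \<longrightarrow> \<gamma> s \<noteq> a \<and> \<gamma> s \<noteq> b))"

definition chaotic_set ::
    "'a::euclidean_space set \<Rightarrow> ('a \<Rightarrow> 'a set) \<Rightarrow> 'a set \<Rightarrow> bool" where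
  "chaotic_set X F V \<longleftrightarrow>
     compact_invariant X F V \<and>
     (\<forall>a\<in>V. \<forall>b\<in>V. \<exists>P. is_simple_path (curves_within X F V) a b P) \<and>
     (\<exists>U. U \<noteq> {} \<and> openin (top_of_set V) U \<and>
        (\<exists>\<gamma>\<in>curves_within X F V. \<forall>t\<ge>0. \<gamma> t \<in> V - U))"

end

theory Submission
  imports Defs
begin

text \<open>
  Close to the saddle \<open>x*\<close> take affine coordinates \<open>(x, y)\<close> along the eigenvectors, with
  \<open>x\<close> along \<open>g(x*)\<close>. On the side of \<open>x*\<close> where \<open>f\<close> points against \<open>g\<close>, both fields
  are transversal to the lines \<open>x = const\<close>, so that in a thin strip away from \<open>x = 0\<close> their
  orbits are graphs over the \<open>x\<close>-axis. The slope of \<open>g\<close> is nearly \<open>0\<close>, whereas the slope of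
  \<open>f\<close> is nearly \<open>(\<mu> y) / (\<lambda> x)\<close> and changes sign with \<open>y\<close>. By an intermediate value argument
  there are an orbit graph \<open>u\<close> of \<open>g\<close> and an orbit graph \<open>w\<close> of \<open>f\<close> with the same end points.
  As \<open>f\<close> and \<open>g\<close> traverse the strip in opposite directions, their graphs form a closed
  trajectory, and the region \<open>V\<close> between them is chaotic: from any point of \<open>V\<close>
  the orbit of \<open>f\<close> ends on \<open>u\<close> and, backwards in time, comes from \<open>u\<close>, while every point of \<open>u\<close>
  is reached by following the boundary. A trajectory avoiding an open part of \<open>V\<close> is the boundary
  itself, or, if \<open>u\<close> and \<open>w\<close> coincide, an oscillation along a part of the common arc.
\<close>

section \<open>Trajectories composed of orbit arcs\<close>

text \<open>Passing \<open>V\<close> as the phase space of \<open>ode_solution\<close> confines the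
  arc to \<open>V\<close>. Fields and durations are hidden, so that motion with switching becomes a
  transitive closure of a relation on points.\<close>

definition arc_of ::
    "('a::euclidean_space \<Rightarrow> 'a) set \<Rightarrow> 'a set \<Rightarrow> 'a \<Rightarrow> 'a \<Rightarrow> bool" where
  "arc_of Fs V a b \<longleftrightarrow>
     (\<exists>h\<in>Fs. \<exists>\<sigma> T. 0 < T \<and> \<sigma> 0 = a \<and> \<sigma> T = b \<and> ode_solution h V {0..T} \<sigma>)"

text \<open>The arcs are run through one after the other. The common lower bound
  \<open>\<tau>\<close> of their durations makes the switching times diverge, so the curve is
  defined for all positive times and switches finitely often in bounded time. The countable set of
  switching times is null.\<close>

lemma concatenated_arcs:
  fixes f g :: "'a::euclidean_space \<Rightarrow> 'a"
  assumes cont: "continuous_on X f" "continuous_on X g" and VX: "V \<subseteq> X"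
    and tau: "0 < \<tau>" "\<And>n. \<tau> \<le> T n"
    and start: "\<And>n. \<sigma> n 0 = p n" and final: "\<And>n. \<sigma> n (T n) = p (Suc n)"
    and sol: "\<And>n. ode_solution (h n) V {0..T n} (\<sigma> n)" and h: "\<And>n. h n \<in> {f, g}"
  obtains \<gamma> where "\<gamma> \<in> curves_within X (\<lambda>x. {f x, g x}) V"
    "\<And>n. \<gamma> (\<Sum>i<n. T i) = p n" "\<And>a b. 0 \<le> a \<Longrightarrow> \<gamma> piecewise_C1_differentiable_on {a..b}"
proof -
  define S where "S n = (\<Sum>i<n. T i)" for n
  have S0: "S 0 = 0" and SSuc: "S (Suc n) = S n + T n" for n by (auto simp: S_def)
  have Tpos: "0 < T n" for n using tau by (meson less_le_trans)
  have Smono: "strict_mono S" by (rule strict_mono_Suc_iff[THEN iffD2]) (simp add: SSuc Tpos)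
  have Slower: "n * \<tau> \<le> S n" for n
  proof (induction n)
    case (Suc n)
    then show ?case using tau(2)[of n] by (simp add: SSuc algebra_simps)
  qed (simp add: S0)
  have ex: "\<exists>n. t < S (Suc n)" for t
  proof -
    obtain n where "t < of_nat n * \<tau>" using reals_Archimedean3[OF tau(1)] by blast
    also have "\<dots> \<le> S n" by (rule Slower)
    also have "\<dots> < S (Suc n)" by (simp add: SSuc Tpos)
    finally show ?thesis by blast
  qed
  define idx where "idx t = (LEAST n. t < S (Suc n))" for t
  have idx_eq: "idx t = n" if "S n \<le> t" "t < S (Suc n)" for t n
    unfolding idx_def
  proof (rule Least_equality)
    fix m assume "t < S (Suc m)"
    then have "S n < S (Suc m)" using that by linarith
    then have "n < Suc m" using Smono by (simp add: strict_mono_less)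
    then show "n \<le> m" by simp
  qed (use that in auto)
  have idx_bounds: "S (idx t) \<le> t \<and> t < S (Suc (idx t))" if "0 \<le> t" for t
  proof
    show "t < S (Suc (idx t))" unfolding idx_def using ex LeastI_ex by metis
    show "S (idx t) \<le> t"
    proof (cases "idx t")
      case 0
      then show ?thesis using that S0 by simp
    next
      case (Suc m)
      then have "\<not> t < S (Suc m)" unfolding idx_def using not_less_Least by (metis lessI)
      then show ?thesis using Suc by simp
    qed
  qed
  define \<gamma> where "\<gamma> t = \<sigma> (idx t) (t - S (idx t))" for t
  \<comment> \<open>At the right end \<open>S (Suc n)\<close> the index has already advanced, but
    the formula persists since arc \<open>n\<close> ends where arc \<open>Suc n\<close> starts.
    Closed intervals are what continuity across a switch needs.\<close>
  have \<gamma>_eq: "\<gamma> t = \<sigma> n (t - S n)" if "t \<in> {S n..S (Suc n)}" for t n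
  proof (cases "t = S (Suc n)")
    case True
    have "idx t = Suc n" using True by (intro idx_eq) (auto simp: SSuc Tpos)
    then show ?thesis using True by (simp add: \<gamma>_def start) (simp add: SSuc final)
  next
    case False
    then have "idx t = n" using that by (intro idx_eq) auto
    then show ?thesis by (simp add: \<gamma>_def)
  qed
  have range: "t - S n \<in> {0..T n}" if "t \<in> {S n..S (Suc n)}" for t n
    using that by (simp add: SSuc)
  have inV: "\<gamma> t \<in> V" if "0 \<le> t" for t
  proof -
    have t: "t \<in> {S (idx t)..S (Suc (idx t))}" using idx_bounds[OF that] by auto
    then show ?thesis
      using \<gamma>_eq[OF t] range[OF t] sol[of "idx t"] by (auto simp: ode_solution_def)
  qed
  have piece: "continuous_on {S n..S (Suc n)} \<gamma>" for n
  proof -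
    have "continuous_on {0..T n} (\<sigma> n)"
      using sol[of n] unfolding ode_solution_def
      by (auto intro!: continuous_on_vector_derivative)
    then have "continuous_on {S n..S (Suc n)} (\<lambda>t. \<sigma> n (t - S n))"
      by (rule continuous_on_compose2) (auto intro!: continuous_intros simp: SSuc)
    then show ?thesis by (rule continuous_on_eq) (simp add: \<gamma>_eq)
  qed
  have pieces: "continuous_on {0..S n} \<gamma>" for n
  proof (induction n)
    case (Suc n)
    have "0 \<le> S n" using Slower[of n] tau(1) by (smt (verit) mult_nonneg_nonneg of_nat_0_le_iff)
    then have "{0..S (Suc n)} = {0..S n} \<union> {S n..S (Suc n)}" using Tpos[of n] by (auto simp: SSuc)
    then show ?case using Suc piece[of n] by (simp add: continuous_on_closed_Un)
  qed (simp add: S0)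
  have cont\<gamma>: "continuous_on {0..} \<gamma>"
  proof (rule continuous_on_eq_continuous_within[THEN iffD2], intro ballI)
    fix t :: real assume t: "t \<in> {0..}"
    obtain n where n: "t < S (Suc n)" using ex by blast
    have "continuous (at t within {0..S (Suc n)}) \<gamma>"
      using pieces[of "Suc n"] t n by (auto simp: continuous_on_eq_continuous_within)
    moreover have "at t within {0..S (Suc n)} = at t within {0..}"
      by (rule at_within_nhd[of _ "{..<S (Suc n)}"]) (use n in auto)
    ultimately show "continuous (at t within {0..}) \<gamma>" by simp
  qed
  define D where "D t = h (idx t) (\<gamma> t)" for t
  have deriv: "(\<gamma> has_vector_derivative h n (\<gamma> t)) (at t)" if "t \<in> {S n<..<S (Suc n)}" for n t
  proof -
    have r: "t - S n \<in> {0<..<T n}" using that by (auto simp: SSuc)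
    then have "(\<sigma> n has_vector_derivative h n (\<sigma> n (t - S n))) (at (t - S n) within {0..T n})"
      using sol[of n] unfolding ode_solution_def by auto
    then have "(\<sigma> n has_vector_derivative h n (\<sigma> n (t - S n))) (at (t - S n))"
      using r at_within_Icc_at[of 0 "t - S n" "T n"] by auto
    then have "(\<sigma> n \<circ> (\<lambda>t. t - S n) has_vector_derivative 1 *\<^sub>R h n (\<sigma> n (t - S n))) (at t)"
      by (intro vector_diff_chain_at) (auto intro!: derivative_eq_intros)
    then have "((\<lambda>t. \<sigma> n (t - S n)) has_vector_derivative h n (\<sigma> n (t - S n))) (at t)"
      by (simp add: o_def)
    then have "(\<gamma> has_vector_derivative h n (\<sigma> n (t - S n))) (at t)"
    proof (rule has_vector_derivative_transform_within_open[OF _ open_greaterThanLessThan that])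
      show "\<sigma> n (s - S n) = \<gamma> s" if "s \<in> {S n<..<S (Suc n)}" for s
        using \<gamma>_eq[of s n] that by simp
    qed
    then show ?thesis using \<gamma>_eq[of t n] that by simp
  qed
  have Deq: "D t = h n (\<gamma> t)" if "t \<in> {S n<..<S (Suc n)}" for n t
    using idx_eq[of n t] that by (simp add: D_def)
  have cover: "\<exists>n. t \<in> {S n<..<S (Suc n)}" if "0 \<le> t" "t \<notin> range S" for t
    using idx_bounds[OF that(1)] that(2) by (metis greaterThanLessThan_iff less_eq_real_def rangeI)
  have contD: "continuous_on (\<Union>n. {S n<..<S (Suc n)}) D"
  proof (rule continuous_on_open_UN)
    fix n
    have sub: "{S n<..<S (Suc n)} \<subseteq> {0..}"
      using Slower[of n] tau(1) by (smt (verit) atLeast_iff greaterThanLessThan_iff mult_nonneg_nonneg of_nat_0_le_iff subsetI)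
    have "continuous_on X (h n)" using h[of n] cont by auto
    then have "continuous_on {S n<..<S (Suc n)} (\<lambda>t. h n (\<gamma> t))"
      using continuous_on_subset[OF cont\<gamma> sub] by (rule continuous_on_compose2) (use inV sub VX in auto)
    then show "continuous_on {S n<..<S (Suc n)} D" by (rule continuous_on_eq) (simp add: Deq)
  qed auto
  have C1: "\<gamma> C1_differentiable_on ({0..} - range S)"
    unfolding C1_differentiable_on_def
  proof (intro exI conjI ballI)
    show "continuous_on ({0..} - range S) D"
      by (rule continuous_on_subset[OF contD]) (use cover in auto)
    fix t assume "t \<in> {0..} - range S"
    then obtain n where "t \<in> {S n<..<S (Suc n)}" using cover by auto
    then show "(\<gamma> has_vector_derivative D t) (at t)" using deriv Deq by simp
  qed
  have negl: "negligible (range S)"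
    unfolding negligible_iff_null_sets
    by (intro null_sets_completionI countable_imp_null_set_lborel) auto
  have AE: "AE t in lebesgue. 0 \<le> t \<longrightarrow> vector_derivative \<gamma> (at t) \<in> {f (\<gamma> t), g (\<gamma> t)}"
  proof (rule AE_I')
    show "range S \<in> null_sets lebesgue" using negl by (simp add: negligible_iff_null_sets)
    show "{t \<in> space lebesgue. \<not> (0 \<le> t \<longrightarrow> vector_derivative \<gamma> (at t) \<in> {f (\<gamma> t), g (\<gamma> t)})} \<subseteq> range S"
    proof (rule subsetI, rule ccontr)
      fix t
      assume t: "t \<in> {t \<in> space lebesgue. \<not> (0 \<le> t \<longrightarrow> vector_derivative \<gamma> (at t) \<in> {f (\<gamma> t), g (\<gamma> t)})}"
        and "t \<notin> range S"
      then obtain n where n: "t \<in> {S n<..<S (Suc n)}" using cover[of t] by auto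
      show False using vector_derivative_at[OF deriv[OF n]] h[of n] t by auto
    qed
  qed
  show ?thesis
  proof
    show "\<gamma> \<in> curves_within X (\<lambda>x. {f x, g x}) V"
      unfolding curves_within_def dyn_system_def curves_def
      using cont\<gamma> C1 negl inV VX AE by auto
    show "\<gamma> (\<Sum>i<n. T i) = p n" for n
      using \<gamma>_eq[of "S n" n] start[of n] Tpos[of n] by (simp add: SSuc S_def)
    show "\<gamma> piecewise_C1_differentiable_on {a..b}" if "0 \<le> a" for a b
      unfolding piecewise_C1_differentiable_on_def
    proof (intro conjI exI)
      show "continuous_on {a..b} \<gamma>" by (rule continuous_on_subset[OF cont\<gamma>]) (use that in auto)
      \<comment> \<open>From index \<open>m\<close> on, \<open>S n\<close> is at least
        \<open>m * \<tau>\<close> and lies beyond \<open>b\<close>.\<close>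
      obtain m :: nat where m: "b < m * \<tau>" using reals_Archimedean3[OF tau(1)] by blast
      have "S n > b" if "m \<le> n" for n
        using m Slower[of m] that Smono by (smt (verit) strict_mono_less_eq)
      then have "{a..b} \<inter> range S \<subseteq> S ` {..<m}" by (force simp: not_le)
      then show "finite ({a..b} \<inter> range S)" by (rule finite_subset) auto
      show "\<gamma> C1_differentiable_on ({a..b} - ({a..b} \<inter> range S))"
        by (rule C1_differentiable_on_subset[OF C1]) (use that in auto)
    qed
  qed
qed

text \<open>The closed chain through \<open>a\<close> and \<open>b\<close> is repeated periodically.
  It consists of finitely many arcs, so their least duration is a positive lower bound as in
  \<open>concatenated_arcs\<close>.\<close>

lemma closed_chain_curve:
  fixes f g :: "'a::euclidean_space \<Rightarrow> 'a"
  assumes cont: "continuous_on X f" "continuous_on X g" and VX: "V \<subseteq> X"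
    and ab: "(arc_of {f, g} V)\<^sup>+\<^sup>+ a b" and ba: "(arc_of {f, g} V)\<^sup>+\<^sup>+ b a"
  obtains \<gamma> s t where "\<gamma> \<in> curves_within X (\<lambda>x. {f x, g x}) V"
    "\<And>a b. 0 \<le> a \<Longrightarrow> \<gamma> piecewise_C1_differentiable_on {a..b}"
    "0 < s" "s < t" "\<gamma> 0 = a" "\<gamma> s = b" "\<gamma> t = a"
proof -
  let ?R = "arc_of {f, g} V"
  obtain n q where n: "0 < n" and q: "q 0 = a" "q n = b" "\<And>i. i < n \<Longrightarrow> ?R (q i) (q (Suc i))"
    using ab unfolding tranclp_power relpowp_fun_conv by blast
  obtain m q' where m: "0 < m" and q': "q' 0 = b" "q' m = a" "\<And>i. i < m \<Longrightarrow> ?R (q' i) (q' (Suc i))"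
    using ba unfolding tranclp_power relpowp_fun_conv by blast
  define c where "c i = (if i \<le> n then q i else q' (i - n))" for i
  have c: "c 0 = a" "c n = b" "c (n + m) = a" using q q' m by (auto simp: c_def)
  have cR: "?R (c i) (c (Suc i))" if "i < n + m" for i
  proof -
    consider "i < n" | "i = n" | "i > n" by linarith
    then show ?thesis
    proof cases
      case 1
      then show ?thesis using q by (simp add: c_def)
    next
      case 2
      then show ?thesis using q q' m q'(3)[of 0] by (simp add: c_def)
    next
      case 3
      then show ?thesis using q'(3)[of "i - n"] that by (simp add: c_def Suc_diff_le)
    qed
  qed
  \<comment> \<open>Wrapping the index around is consistent because \<open>c (n + m)\<close> and
    \<open>c 0\<close> are both \<open>a\<close>.\<close>
  define p where "p i = c (i mod (n + m))" for i
  have pR: "?R (p i) (p (Suc i))" for i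
  proof -
    have "i mod (n + m) < n + m" using n by simp
    from cR[OF this] show ?thesis using n c by (auto simp: p_def mod_Suc split: if_splits)
  qed
  define G where "G x y h \<sigma> T \<longleftrightarrow> h \<in> {f, g} \<and> 0 < T \<and> \<sigma> 0 = x \<and> \<sigma> T = y \<and> ode_solution h V {0..T} \<sigma>"
    for x y and h :: "'a \<Rightarrow> 'a" and \<sigma> :: "real \<Rightarrow> 'a" and T :: real
  have "\<forall>i\<in>{..<n + m}. \<exists>h \<sigma> T. G (c i) (c (Suc i)) h \<sigma> T"
    using cR unfolding arc_of_def G_def by blast
  then obtain h \<sigma> T where G: "\<And>i. i < n + m \<Longrightarrow> G (c i) (c (Suc i)) (h i) (\<sigma> i) (T i)"
    by (metis lessThan_iff)
  define \<tau> where "\<tau> = Min (T ` {..<n + m})"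
  have ne: "{..<n + m} \<noteq> {}" using n by auto
  have \<tau>0: "0 < \<tau>" using ne G by (auto simp: \<tau>_def Min_gr_iff G_def)
  have \<tau>: "\<tau> \<le> T i" if "i < n + m" for i using that by (auto simp: \<tau>_def intro: Min_le)
  have lt: "i mod (n + m) < n + m" for i using n by simp
  have cS: "c (Suc (i mod (n + m))) = p (Suc i)" for i
    using n c by (auto simp: p_def mod_Suc)
  let ?k = "\<lambda>i. i mod (n + m)"
  have G': "G (p i) (p (Suc i)) (h (?k i)) (\<sigma> (?k i)) (T (?k i))" for i
    using G[OF lt[of i]] cS[of i] by (simp add: p_def)
  obtain \<gamma> where \<gamma>: "\<gamma> \<in> curves_within X (\<lambda>x. {f x, g x}) V"
    "\<And>j. \<gamma> (\<Sum>i<j. T (?k i)) = p j" "\<And>a b. 0 \<le> a \<Longrightarrow> \<gamma> piecewise_C1_differentiable_on {a..b}"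
    using concatenated_arcs[OF cont VX \<tau>0, of "\<lambda>i. T (?k i)" "\<lambda>i. \<sigma> (?k i)" p "\<lambda>i. h (?k i)"]
      \<tau>[OF lt] G' unfolding G_def by blast
  have Tpos: "0 < T (?k i)" for i using G'[of i] by (simp add: G_def)
  show ?thesis
  proof (rule that[OF \<gamma>(1) \<gamma>(3)])
    show "0 < (\<Sum>i<n. T (?k i))" using n Tpos by (intro sum_pos) (auto simp del: mod_less)
    show "(\<Sum>i<n. T (?k i)) < (\<Sum>i<n + m. T (?k i))"
    proof (rule sum_strict_mono2)
      show "n \<in> {..<n + m} - {..<n}" using m by simp
    qed (use Tpos in \<open>auto simp del: mod_less intro: less_imp_le\<close>)
    show "\<gamma> 0 = a" "\<gamma> (\<Sum>i<n. T (?k i)) = b" "\<gamma> (\<Sum>i<n + m. T (?k i)) = a"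
      using \<gamma>(2)[of 0] \<gamma>(2)[of n] \<gamma>(2)[of "n + m"] c m by (auto simp: p_def)
  qed
qed

section \<open>A criterion for chaotic sets\<close>

text \<open>The preimage of a point is compact and has a least and a greatest element. These times
  trim a trajectory to a simple path, which must not meet its end points in between.\<close>

lemma first_and_last_visit:
  fixes \<gamma> :: "real \<Rightarrow> 'a::euclidean_space"
  assumes cont: "continuous_on {s..t} \<gamma>" and "s \<le> t"
  shows "\<gamma> t = b \<Longrightarrow> \<exists>r\<in>{s..t}. \<gamma> r = b \<and> (\<forall>q. s \<le> q \<and> q < r \<longrightarrow> \<gamma> q \<noteq> b)"
    and "\<gamma> s = a \<Longrightarrow> \<exists>r\<in>{s..t}. \<gamma> r = a \<and> (\<forall>q. r < q \<and> q \<le> t \<longrightarrow> \<gamma> q \<noteq> a)"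
proof -
  have comp: "compact {r \<in> {s..t}. \<gamma> r = x}" for x
    using continuous_closed_preimage_constant[OF cont closed_atLeastAtMost, of x]
    by (auto simp: compact_eq_bounded_closed intro: bounded_subset[OF bounded_closed_interval[of s t]])
  show "\<exists>r\<in>{s..t}. \<gamma> r = b \<and> (\<forall>q. s \<le> q \<and> q < r \<longrightarrow> \<gamma> q \<noteq> b)" if b: "\<gamma> t = b"
  proof -
    have "{r \<in> {s..t}. \<gamma> r = b} \<noteq> {}" using b assms(2) by force
    from compact_attains_inf[OF comp this] obtain r
      where "r \<in> {s..t}" "\<gamma> r = b" "\<forall>q\<in>{r \<in> {s..t}. \<gamma> r = b}. r \<le> q" by auto
    then show ?thesis by (intro bexI[of _ r]) (auto simp: not_le[symmetric])
  qed
  show "\<exists>r\<in>{s..t}. \<gamma> r = a \<and> (\<forall>q. r < q \<and> q \<le> t \<longrightarrow> \<gamma> q \<noteq> a)" if a: "\<gamma> s = a"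
  proof -
    have "{r \<in> {s..t}. \<gamma> r = a} \<noteq> {}" using a assms(2) by force
    from compact_attains_sup[OF comp this] obtain r
      where "r \<in> {s..t}" "\<gamma> r = a" "\<forall>q\<in>{r \<in> {s..t}. \<gamma> r = a}. q \<le> r" by auto
    then show ?thesis by (intro bexI[of _ r]) (auto, metis leD order.trans less_imp_le)
  qed
qed

text \<open>Invariance and simple paths come from closed chains through two given points. The loop
  inside \<open>W\<close> yields the trajectory that avoids the relatively open set
  \<open>V - W\<close>; its two distinct points ensure that each point of \<open>V\<close> has
  another one to travel to.\<close>

lemma chaotic_setI:
  fixes f g :: "'a::euclidean_space \<Rightarrow> 'a"
  assumes cont: "continuous_on X f" "continuous_on X g" and VX: "V \<subseteq> X" and V: "compact V"
    and conn: "\<And>a b. a \<in> V \<Longrightarrow> b \<in> V \<Longrightarrow> a \<noteq> b \<Longrightarrow> (arc_of {f, g} V)\<^sup>+\<^sup>+ a b"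
    and W: "closed W" "W \<subset> V"
    and loop: "(arc_of {f, g} W)\<^sup>+\<^sup>+ a0 b0" "(arc_of {f, g} W)\<^sup>+\<^sup>+ b0 a0" "a0 \<noteq> b0" "a0 \<in> V" "b0 \<in> V"
  shows "chaotic_set X (\<lambda>x. {f x, g x}) V"
proof -
  let ?C = "curves_within X (\<lambda>x. {f x, g x})"
  have round: "\<exists>\<gamma> s t. \<gamma> \<in> ?C V \<and>
      (\<forall>a b. 0 \<le> a \<longrightarrow> \<gamma> piecewise_C1_differentiable_on {a..b}) \<and>
      0 < s \<and> s < t \<and> \<gamma> 0 = a \<and> \<gamma> s = b \<and> \<gamma> t = a"
    if "a \<in> V" "b \<in> V" "a \<noteq> b" for a b
    using closed_chain_curve[OF cont VX, of a b] conn[OF that] conn[of b a] that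
    by (smt (verit, best))
  have other: "\<exists>b\<in>V. b \<noteq> a" for a using loop by metis
  have "compact_invariant X (\<lambda>x. {f x, g x}) V"
    unfolding compact_invariant_def
  proof (intro conjI ballI)
    show "V \<noteq> {}" using loop by auto
    fix x assume x: "x \<in> V"
    obtain b where "b \<in> V" "b \<noteq> x" using other by blast
    then obtain \<gamma> where "\<gamma> \<in> ?C V" "\<gamma> 0 = x" using round[OF x, of b] by blast
    then show "\<exists>\<gamma>\<in>dyn_system X (\<lambda>x. {f x, g x}). \<gamma> 0 = x \<and> (\<forall>t\<ge>0. \<gamma> t \<in> V)"
      by (auto simp: curves_within_def)
  qed (use VX V in auto)
  moreover have "\<exists>P. is_simple_path (?C V) a b P" if a: "a \<in> V" and b: "b \<in> V" for a b
  proof (cases "a = b")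
    case True
    \<comment> \<open>A path from \<open>a\<close> to itself makes a detour through some
      \<open>c\<close>: it lasts from the final visit of \<open>a\<close> before \<open>c\<close> to
      the first return after \<open>c\<close>.\<close>
    obtain c where "c \<in> V" "c \<noteq> a" using other by blast
    then obtain \<gamma> s t where \<gamma>: "\<gamma> \<in> ?C V" "\<And>a b. 0 \<le> a \<Longrightarrow> \<gamma> piecewise_C1_differentiable_on {a..b}"
      "0 < s" "s < t" "\<gamma> 0 = a" "\<gamma> s = c" "\<gamma> t = a" using round[OF a, of c] by blast
    have c\<gamma>: "continuous_on {0..} \<gamma>" using \<gamma>(1) by (auto simp: curves_within_def dyn_system_def curves_def)
    have "continuous_on {0..s} \<gamma>" "continuous_on {s..t} \<gamma>"
      by (rule continuous_on_subset[OF c\<gamma>]; use \<gamma> in auto)+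
    then obtain t0 t1 where t0: "t0 \<in> {0..s}" "\<gamma> t0 = a" "\<forall>q. t0 < q \<and> q \<le> s \<longrightarrow> \<gamma> q \<noteq> a"
      and t1: "t1 \<in> {s..t}" "\<gamma> t1 = a" "\<forall>q. s \<le> q \<and> q < t1 \<longrightarrow> \<gamma> q \<noteq> a"
      using first_and_last_visit(2)[of 0 s \<gamma> a] first_and_last_visit(1)[of s t \<gamma> a] \<gamma>
      by (metis less_eq_real_def)
    have "t0 \<noteq> s" using t0 \<gamma> \<open>c \<noteq> a\<close> by auto
    have "is_simple_path (?C V) a b (\<gamma> ` {t0..t1})"
      unfolding is_simple_path_def
      by (rule bexI[OF _ \<gamma>(1)], rule exI[of _ t0], rule exI[of _ t1])
        (use t0 t1 \<gamma>(2) \<open>t0 \<noteq> s\<close> True in \<open>auto; metis linear\<close>)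
    then show ?thesis by blast
  next
    case False
    then obtain \<gamma> s where \<gamma>: "\<gamma> \<in> ?C V" "\<And>a b. 0 \<le> a \<Longrightarrow> \<gamma> piecewise_C1_differentiable_on {a..b}"
      "0 < s" "\<gamma> 0 = a" "\<gamma> s = b" using round[OF a b] by blast
    have c\<gamma>: "continuous_on {0..} \<gamma>" using \<gamma>(1) by (auto simp: curves_within_def dyn_system_def curves_def)
    have "continuous_on {0..s} \<gamma>"
      by (rule continuous_on_subset[OF c\<gamma>]) (use \<gamma> in auto)
    \<comment> \<open>The first arrival at \<open>b\<close> is fixed before the last departure from
      \<open>a\<close> is sought on \<open>{0..t1}\<close>; restricting further from the left keeps
      \<open>t1\<close> the first arrival.\<close>
    then obtain t1 where t1: "t1 \<in> {0..s}" "\<gamma> t1 = b" "\<forall>q. 0 \<le> q \<and> q < t1 \<longrightarrow> \<gamma> q \<noteq> b"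
      using first_and_last_visit(1)[of 0 s \<gamma> b] \<gamma> by (metis less_eq_real_def)
    have "continuous_on {0..t1} \<gamma>"
      by (rule continuous_on_subset[OF c\<gamma>]) auto
    then obtain t0 where t0: "t0 \<in> {0..t1}" "\<gamma> t0 = a" "\<forall>q. t0 < q \<and> q \<le> t1 \<longrightarrow> \<gamma> q \<noteq> a"
      using first_and_last_visit(2)[of 0 t1 \<gamma> a] \<gamma> t1 by auto
    have "t0 \<noteq> t1" using t0 t1 False by auto
    have "is_simple_path (?C V) a b (\<gamma> ` {t0..t1})"
      unfolding is_simple_path_def
      by (rule bexI[OF _ \<gamma>(1)], rule exI[of _ t0], rule exI[of _ t1])
        (use t0 t1 \<gamma>(2) \<open>t0 \<noteq> t1\<close> in auto)
    then show ?thesis by blast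
  qed
  moreover have "\<exists>U. U \<noteq> {} \<and> openin (top_of_set V) U \<and> (\<exists>\<gamma>\<in>?C V. \<forall>t\<ge>0. \<gamma> t \<in> V - U)"
  proof (intro exI conjI)
    show "V - W \<noteq> {}" using W by blast
    show "openin (top_of_set V) (V - W)" using W by (metis Diff_eq open_Compl openin_open_Int)
    have "W \<subseteq> X" using W VX by blast
    then obtain \<gamma> where "\<gamma> \<in> ?C W"
      using closed_chain_curve[OF cont _ loop(1,2)] by (smt (verit, best))
    then show "\<exists>\<gamma>\<in>?C V. \<forall>t\<ge>0. \<gamma> t \<in> V - (V - W)"
      using W by (intro bexI[of _ \<gamma>]) (auto simp: curves_within_def)
  qed
  ultimately show ?thesis unfolding chaotic_set_def by blast
qed

section \<open>Mean value estimates and exit from a box\<close>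

text \<open>Mean value theorem. The rate is assumed strictly inside the interval, which suits exit
  times: there the position in the box is known only before the exit.\<close>

lemma growth_bounds:
  fixes p p' :: "real \<Rightarrow> real"
  assumes d: "\<And>t. t \<in> {l..u} \<Longrightarrow> (p has_vector_derivative p' t) (at t within {l..u})"
    and ab: "l \<le> a" "a \<le> b" "b \<le> u" and r: "\<And>t. a < t \<Longrightarrow> t < b \<Longrightarrow> r \<le> p' t"
  shows "r * (b - a) \<le> p b - p a"
proof (cases "a = b")
  case False
  then have "a < b" using ab by simp
  then obtain t where "t \<in> {a<..<b}" "p b - p a = (b - a) *\<^sub>R p' t"
    using mvt_simple[of a b p "\<lambda>t h. h *\<^sub>R p' t"] d ab has_derivative_subset
    unfolding has_vector_derivative_def
    by (smt (verit, ccfv_threshold) atLeastAtMost_iff atLeastatMost_subset_iff)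
  then show ?thesis using r[of t] \<open>a < b\<close> by (simp add: mult.commute mult_left_mono)
qed simp

text \<open>The function \<open>q - k * p\<close> is nondecreasing. This form bounds the slope of a
  curve without dividing by \<open>p'\<close>.\<close>

lemma oblique_growth:
  fixes p q :: "real \<Rightarrow> real"
  assumes d: "\<And>t. t \<in> {l..u} \<Longrightarrow> (p has_vector_derivative p' t) (at t within {l..u})"
    "\<And>t. t \<in> {l..u} \<Longrightarrow> (q has_vector_derivative q' t) (at t within {l..u})"
    and ab: "l \<le> a" "a \<le> b" "b \<le> u" and r: "\<And>t. a < t \<Longrightarrow> t < b \<Longrightarrow> k * p' t \<le> q' t"
  shows "k * (p b - p a) \<le> q b - q a"
proof -
  have "0 * (b - a) \<le> (q b - k * p b) - (q a - k * p a)"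
  proof (rule growth_bounds[of l u "\<lambda>t. q t - k * p t" "\<lambda>t. q' t - k * p' t"])
    show "((\<lambda>t. q t - k * p t) has_vector_derivative q' t - k * p' t) (at t within {l..u})"
      if "t \<in> {l..u}" for t
      by (intro derivative_intros d that)
  qed (use ab r in auto)
  then show ?thesis by (simp add: algebra_simps)
qed

text \<open>First exit from the box \<open>{x0..x2} \<times> {-1..1}\<close>. An exit occurs, since
  speed \<open>c\<close> exceeds the width within time \<open>E\<close>. It is not on the left, as
  \<open>p\<close> grows from a value above \<open>x0\<close>, nor at top or bottom, as
  \<open>q\<close> starts within 1/2 and changes by at most
  \<open>M * (x2 - x0) < 1/2\<close>.\<close>

lemma reaches_right_end:
  fixes p q p' q' :: "real \<Rightarrow> real"
  assumes dp: "\<And>t. t \<in> {0..E} \<Longrightarrow> (p has_vector_derivative p' t) (at t within {0..E})"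
    and dq: "\<And>t. t \<in> {0..E} \<Longrightarrow> (q has_vector_derivative q' t) (at t within {0..E})"
    and speed: "\<And>t. t \<in> {0..E} \<Longrightarrow> p t \<in> {x0..x2} \<Longrightarrow> \<bar>q t\<bar> \<le> 1 \<Longrightarrow> c \<le> p' t \<and> \<bar>q' t\<bar> \<le> M * p' t"
    and pos: "0 < c" "0 \<le> M" "0 < E" and start: "x0 < p 0" "p 0 \<le> x2" "\<bar>q 0\<bar> \<le> 1/2"
    and narrow: "M * (x2 - x0) < 1/2" and time: "x2 - x0 < c * E"
  shows "\<exists>T\<in>{0..E}. p T = x2 \<and> (\<forall>t\<in>{0..T}. p t \<in> {p 0..x2} \<and> \<bar>q t\<bar> \<le> 1)"
proof -
  have cp: "continuous_on {0..E} p" and cq: "continuous_on {0..E} q"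
    by (rule continuous_on_vector_derivative, erule dp dq)+
  \<comment> \<open>The times at which the point is on the boundary of the box or outside; the least
    of them is the exit time \<open>T\<close>.\<close>
  define C where "C = {0..E} \<inter> p -` {x2..} \<union> ({0..E} \<inter> (\<lambda>t. \<bar>q t\<bar>) -` {1..} \<union> {0..E} \<inter> p -` {..x0})"
  have "closed C"
    unfolding C_def by (intro closed_Un continuous_closed_preimage cp continuous_on_rabs cq) auto
  then have comp: "compact C"
    by (auto simp: compact_eq_bounded_closed C_def intro!: bounded_subset[OF bounded_closed_interval[of 0 E]])
  have "C \<noteq> {}"
  proof
    assume "C = {}"
    then have box: "p t < x2 \<and> \<bar>q t\<bar> < 1 \<and> x0 < p t" if "t \<in> {0..E}" for t
      using that unfolding C_def by (auto simp: not_le[symmetric])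
    have "c * (E - 0) \<le> p E - p 0"
      by (rule growth_bounds[OF dp]) (use pos box speed in \<open>auto simp: less_imp_le\<close>)
    moreover have "p E < x2" using box[of E] pos by auto
    ultimately show False using time start by simp
  qed
  then obtain T where T: "T \<in> C" and Tmin: "\<And>t. t \<in> C \<Longrightarrow> T \<le> t"
    using compact_attains_inf[OF comp] by blast
  have TE: "T \<in> {0..E}" using T by (auto simp: C_def)
  have box: "p t < x2 \<and> \<bar>q t\<bar> < 1 \<and> x0 < p t" if "t \<in> {0..<T}" for t
    using that TE Tmin[of t] unfolding C_def by (auto simp: not_le[symmetric])
  have dir: "c \<le> p' t \<and> \<bar>q' t\<bar> \<le> M * p' t" if "0 < t" "t < T" for t
    using speed[of t] box[of t] that TE by auto
  have up: "c * (t - 0) \<le> p t - p 0" if "t \<in> {0..T}" for t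
    by (rule growth_bounds[OF dp]) (use that TE dir in auto)
  have pge: "p 0 \<le> p t" if "t \<in> {0..T}" for t
    using up[OF that] that pos by (smt (verit) atLeastAtMost_iff mult_nonneg_nonneg)
  have qU: "-M * (p T - p 0) \<le> q T - q 0"
    by (rule oblique_growth[OF dp dq]) (use TE dir in force)+
  have qL: "-M * (p T - p 0) \<le> - q T - - q 0"
    by (rule oblique_growth[OF dp, where q' = "\<lambda>t. - q' t"])
      (use TE dir in \<open>force intro!: derivative_intros dq\<close>)+
  \<comment> \<open>A value above \<open>x2\<close> at time \<open>T\<close> would force an earlier
    passage through \<open>x2\<close>, where \<open>box\<close> still holds.\<close>
  have pT: "p T \<le> x2"
  proof (rule ccontr)
    assume "\<not> p T \<le> x2"
    then obtain s where "s \<in> {0..T}" "p s = x2"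
      using IVT'[of p 0 x2 T] start TE continuous_on_subset[OF cp, of "{0..T}"] by force
    moreover have "s \<noteq> T" using \<open>p s = x2\<close> \<open>\<not> p T \<le> x2\<close> by auto
    ultimately show False using box[of s] by auto
  qed
  have "M * (p T - p 0) \<le> M * (x2 - x0)" using pT start pos by (intro mult_left_mono) auto
  then have qT: "\<bar>q T\<bar> < 1" using qU qL start narrow by auto
  have "p T = x2" using T pT qT pge[of T] TE start by (auto simp: C_def)
  moreover have "p t \<in> {p 0..x2} \<and> \<bar>q t\<bar> \<le> 1" if "t \<in> {0..T}" for t
    using pge[OF that] box[of t] pT qT that by (cases "t = T") auto
  ultimately show ?thesis using TE by blast
qed

section \<open>Orbits as graphs over a strip\<close>

text \<open>The phase space is exchanged as well, for any set that contains the arc; this is how a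
  solution in \<open>X\<close> becomes an arc in a smaller region.\<close>

lemma ode_solution_subinterval:
  "ode_solution h X I \<sigma> \<Longrightarrow> \<sigma> ` {a..b} \<subseteq> Y \<Longrightarrow> {a..b} \<subseteq> I \<Longrightarrow> ode_solution h Y {a..b} \<sigma>"
  unfolding ode_solution_def
  by (meson has_vector_derivative_within_subset is_interval_cc subsetD)

lemma ode_solution_shift:
  assumes "ode_solution h X {a..b} \<sigma>"
  shows "ode_solution h X {a - r..b - r} (\<lambda>t. \<sigma> (t + r))"
  unfolding ode_solution_def
proof (intro conjI ballI)
  fix t assume t: "t \<in> {a - r..b - r}"
  have "(\<sigma> has_vector_derivative h (\<sigma> (t + r))) (at (t + r) within {a..b})"
    using assms t by (auto simp: ode_solution_def)
  moreover have "(\<lambda>t. t + r) ` {a - r..b - r} = {a..b}" by simp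
  moreover have "((\<lambda>t. t + r) has_vector_derivative 1) (at t within {a - r..b - r})"
    by (auto intro!: derivative_eq_intros)
  ultimately show "((\<lambda>t. \<sigma> (t + r)) has_vector_derivative h (\<sigma> (t + r))) (at t within {a - r..b - r})"
    using vector_diff_chain_within[of "\<lambda>t. t + r" 1 t "{a - r..b - r}" \<sigma>] by (auto simp: o_def)
qed (use assms in \<open>auto simp: ode_solution_def is_interval_cc\<close>)

lemma ode_solution_reverse:
  assumes "ode_solution h X I \<sigma>"
  shows "ode_solution (\<lambda>x. - h x) X (uminus ` I) (\<lambda>t. \<sigma> (- t))"
  unfolding ode_solution_def
proof (intro conjI ballI)
  fix t assume t: "t \<in> uminus ` I"
  have "(\<sigma> has_vector_derivative h (\<sigma> (- t))) (at (- t) within I)"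
    using assms t by (auto simp: ode_solution_def)
  moreover have "uminus ` uminus ` I = I" by (simp add: image_comp)
  moreover have "(uminus has_vector_derivative (-1::real)) (at t within uminus ` I)"
    by (auto intro!: derivative_eq_intros)
  ultimately show "((\<lambda>t. \<sigma> (- t)) has_vector_derivative - h (\<sigma> (- t))) (at t within uminus ` I)"
    using vector_diff_chain_within[of uminus "-1" t "uminus ` I" \<sigma> "h (\<sigma> (- t))"] by (simp add: o_def)
qed (use assms in \<open>auto simp: ode_solution_def\<close>)

text \<open>The part of the flow property that makes orbits disjoint or equal. Isolated like this,
  it passes to \<open>- h\<close> by reversing time.\<close>

definition unique_solutions :: "('a::euclidean_space \<Rightarrow> 'a) \<Rightarrow> 'a set \<Rightarrow> bool" where
  "unique_solutions h X \<longleftrightarrow>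
     (\<forall>I1 I2 \<sigma>1 \<sigma>2. ode_solution h X I1 \<sigma>1 \<and> ode_solution h X I2 \<sigma>2 \<and> 0 \<in> I1 \<inter> I2 \<and> \<sigma>1 0 = \<sigma>2 0
        \<longrightarrow> (\<forall>t\<in>I1 \<inter> I2. \<sigma>1 t = \<sigma>2 t))"

lemma unique_solutions_reverse:
  assumes "unique_solutions h X"
  shows "unique_solutions (\<lambda>x. - h x) X"
  unfolding unique_solutions_def
proof (intro allI impI ballI)
  fix I1 I2 \<sigma>1 \<sigma>2 and t :: real
  assume *: "ode_solution (\<lambda>x. - h x) X I1 \<sigma>1 \<and> ode_solution (\<lambda>x. - h x) X I2 \<sigma>2 \<and> 0 \<in> I1 \<inter> I2 \<and> \<sigma>1 0 = \<sigma>2 0"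
    and t: "t \<in> I1 \<inter> I2"
  have "ode_solution h X (uminus ` I1) (\<lambda>t. \<sigma>1 (- t))" "ode_solution h X (uminus ` I2) (\<lambda>t. \<sigma>2 (- t))"
    using * ode_solution_reverse[of "\<lambda>x. - h x"] by auto
  moreover have "0 \<in> uminus ` I1 \<inter> uminus ` I2" "-t \<in> uminus ` I1 \<inter> uminus ` I2"
    using * t by force+
  ultimately show "\<sigma>1 t = \<sigma>2 t"
    using assms * unfolding unique_solutions_def by (metis (mono_tags, lifting) minus_zero minus_minus)
qed

section \<open>Affine coordinates\<close>

text \<open>\<open>Lx\<close> and \<open>Ly\<close> are the basis dual to \<open>e\<close>,
  \<open>e'\<close>. The origin \<open>xs\<close> enters only the coordinates defined below, so the
  predicate \<open>chart\<close> has no argument for it and may be interpreted with any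
  origin.\<close>

locale chart =
  fixes xs e e' :: "'a::euclidean_space" and Lx Ly :: "'a \<Rightarrow> real"
  assumes Lx: "bounded_linear Lx" and Ly: "bounded_linear Ly"
    and expansion: "z = Lx z *\<^sub>R e + Ly z *\<^sub>R e'"
    and dual: "Lx e = 1" "Lx e' = 0" "Ly e = 0" "Ly e' = 1"
begin

definition H :: "real \<Rightarrow> real \<Rightarrow> 'a" where "H x y = xs + x *\<^sub>R e + y *\<^sub>R e'"

definition cx :: "'a \<Rightarrow> real" where "cx z = Lx (z - xs)"

definition cy :: "'a \<Rightarrow> real" where "cy z = Ly (z - xs)"

lemma cx_H [simp]: "cx (H x y) = x" and cy_H [simp]: "cy (H x y) = y"
  by (simp_all add: cx_def cy_def H_def dual add.assoc
      linear_add[OF bounded_linear.linear[OF Lx]] linear_add[OF bounded_linear.linear[OF Ly]]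
      linear_scale[OF bounded_linear.linear[OF Lx]] linear_scale[OF bounded_linear.linear[OF Ly]])

lemma H_cx_cy [simp]: "H (cx z) (cy z) = z"
  using expansion[of "z - xs"] by (simp add: H_def cx_def cy_def add.assoc)

lemma H_eq_iff [simp]: "H x y = H x' y' \<longleftrightarrow> x = x' \<and> y = y'"
  by (metis cx_H cy_H)

lemma continuous_on_H [continuous_intros]:
  "continuous_on S p \<Longrightarrow> continuous_on S q \<Longrightarrow> continuous_on S (\<lambda>t. H (p t) (q t))"
  unfolding H_def by (intro continuous_intros)

lemma coordinates_derivative:
  assumes "(\<sigma> has_vector_derivative d) F"
  shows "((\<lambda>t. cx (\<sigma> t)) has_vector_derivative Lx d) F" "((\<lambda>t. cy (\<sigma> t)) has_vector_derivative Ly d) F"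
  unfolding cx_def cy_def
  using assms
  by (auto intro!: bounded_linear.has_vector_derivative[OF Lx] bounded_linear.has_vector_derivative[OF Ly]
      derivative_eq_intros)

end

text \<open>
  The field \<open>h\<close> is \<open>f\<close> or \<open>g\<close> up to sign, the sign being chosen such that \<open>h\<close> points to the right.
  Solutions live for time \<open>E\<close> in either direction, which suffices to cross the strip at speed \<open>c\<close>;
  the interval \<open>{x0..x3}\<close> leaves room around the interval \<open>{x1..x2}\<close> over which graphs are taken.
\<close>

locale strip_field = chart xs e e' Lx Ly
  for xs e e' :: "'a::euclidean_space" and Lx Ly :: "'a \<Rightarrow> real" +
  fixes x0 x1 x2 x3 c M E :: real and X :: "'a set" and h :: "'a \<Rightarrow> 'a"
  assumes xs_order: "x0 < x1" "x1 < x2" "x2 < x3"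
    and strip_bounds: "0 < c" "0 \<le> M" "0 < E" "M * (x3 - x0) \<le> 1/8" "x3 - x0 < c * E"
    and speed: "\<And>z. cx z \<in> {x0..x3} \<Longrightarrow> \<bar>cy z\<bar> \<le> 1 \<Longrightarrow> c \<le> Lx (h z) \<and> \<bar>Ly (h z)\<bar> \<le> M * Lx (h z)"
    and solvable: "\<And>z. cx z \<in> {x0..x3} \<Longrightarrow> \<bar>cy z\<bar> \<le> 1 \<Longrightarrow> \<exists>\<sigma>. \<sigma> 0 = z \<and> ode_solution h X {-E..E} \<sigma>"
    and unique: "unique_solutions h X"
begin

text \<open>Describes an orbit crossing the strip independently of its time parametrization. Only
  the values of \<open>v\<close> on \<open>{x1..x2}\<close> are determined. That the first
  coordinate increases and covers \<open>{x1..x2}\<close> follows from the speed bound, see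
  \<open>orbit_graph_param\<close>.\<close>

definition orbit_graph :: "(real \<Rightarrow> real) \<Rightarrow> bool" where
  "orbit_graph v \<longleftrightarrow> (\<exists>a b \<sigma>. a \<le> b \<and> ode_solution h X {a..b} \<sigma> \<and> cx (\<sigma> a) = x1 \<and> cx (\<sigma> b) = x2 \<and>
     (\<forall>t\<in>{a..b}. cx (\<sigma> t) \<in> {x1..x2} \<and> \<bar>cy (\<sigma> t)\<bar> \<le> 1 \<and> v (cx (\<sigma> t)) = cy (\<sigma> t)))"

text \<open>Growth estimates for the coordinates of a solution. The slope bound \<open>k\<close> is
  asked for only at points of the orbit, because later bounds for one field hold only away from the
  axis \<open>y = 0\<close>.\<close>

lemma solution_in_box:
  assumes sol: "ode_solution h X {a..b} \<sigma>"
    and box: "\<And>t. t \<in> {a..b} \<Longrightarrow> cx (\<sigma> t) \<in> {x0..x3} \<and> \<bar>cy (\<sigma> t)\<bar> \<le> 1"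
    and st: "a \<le> s" "s \<le> t" "t \<le> b"
  shows "c * (t - s) \<le> cx (\<sigma> t) - cx (\<sigma> s)"
    and "\<And>k. (\<And>z. cx z \<in> {x0..x3} \<Longrightarrow> \<bar>cy z\<bar> \<le> 1 \<Longrightarrow> z \<in> \<sigma> ` {a..b} \<Longrightarrow> k * Lx (h z) \<le> Ly (h z)) \<Longrightarrow>
            k * (cx (\<sigma> t) - cx (\<sigma> s)) \<le> cy (\<sigma> t) - cy (\<sigma> s)"
    and "\<And>k. (\<And>z. cx z \<in> {x0..x3} \<Longrightarrow> \<bar>cy z\<bar> \<le> 1 \<Longrightarrow> z \<in> \<sigma> ` {a..b} \<Longrightarrow> Ly (h z) \<le> k * Lx (h z)) \<Longrightarrow>
            cy (\<sigma> t) - cy (\<sigma> s) \<le> k * (cx (\<sigma> t) - cx (\<sigma> s))"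
proof -
  have d: "((\<lambda>t. cx (\<sigma> t)) has_vector_derivative Lx (h (\<sigma> t))) (at t within {a..b})"
    "((\<lambda>t. cy (\<sigma> t)) has_vector_derivative Ly (h (\<sigma> t))) (at t within {a..b})" if "t \<in> {a..b}" for t
    using sol that by (auto simp: ode_solution_def intro!: coordinates_derivative)
  show "c * (t - s) \<le> cx (\<sigma> t) - cx (\<sigma> s)"
    by (rule growth_bounds[OF d(1)]) (use st box speed in auto)
  show "k * (cx (\<sigma> t) - cx (\<sigma> s)) \<le> cy (\<sigma> t) - cy (\<sigma> s)"
    if "\<And>z. cx z \<in> {x0..x3} \<Longrightarrow> \<bar>cy z\<bar> \<le> 1 \<Longrightarrow> z \<in> \<sigma> ` {a..b} \<Longrightarrow> k * Lx (h z) \<le> Ly (h z)" for k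
    by (rule oblique_growth[OF d]) (use st box that in auto)
  show "cy (\<sigma> t) - cy (\<sigma> s) \<le> k * (cx (\<sigma> t) - cx (\<sigma> s))"
    if "\<And>z. cx z \<in> {x0..x3} \<Longrightarrow> \<bar>cy z\<bar> \<le> 1 \<Longrightarrow> z \<in> \<sigma> ` {a..b} \<Longrightarrow> Ly (h z) \<le> k * Lx (h z)" for k
  proof -
    have "- k * (cx (\<sigma> t) - cx (\<sigma> s)) \<le> - cy (\<sigma> t) - - cy (\<sigma> s)"
      by (rule oblique_growth[OF d(1) has_vector_derivative_minus[OF d(2)]]) (use st box that in auto)
    then show ?thesis by simp
  qed
qed

text \<open>Positive speed makes the first coordinate strictly increasing, and the intermediate
  value theorem makes it cover \<open>{x1..x2}\<close>.\<close>

lemma orbit_graph_param: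
  assumes "orbit_graph v"
  obtains a b \<sigma> where "a \<le> b" "ode_solution h X {a..b} \<sigma>" "cx (\<sigma> a) = x1" "cx (\<sigma> b) = x2"
    "\<And>t. t \<in> {a..b} \<Longrightarrow> cx (\<sigma> t) \<in> {x1..x2} \<and> \<bar>cy (\<sigma> t)\<bar> \<le> 1 \<and> v (cx (\<sigma> t)) = cy (\<sigma> t)"
    "\<And>s t. a \<le> s \<Longrightarrow> s < t \<Longrightarrow> t \<le> b \<Longrightarrow> cx (\<sigma> s) < cx (\<sigma> t)"
    "\<And>x. x \<in> {x1..x2} \<Longrightarrow> \<exists>t\<in>{a..b}. \<sigma> t = H x (v x)"
proof -
  obtain a b \<sigma> where *: "a \<le> b" "ode_solution h X {a..b} \<sigma>" "cx (\<sigma> a) = x1" "cx (\<sigma> b) = x2"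
    and box: "\<And>t. t \<in> {a..b} \<Longrightarrow> cx (\<sigma> t) \<in> {x1..x2} \<and> \<bar>cy (\<sigma> t)\<bar> \<le> 1 \<and> v (cx (\<sigma> t)) = cy (\<sigma> t)"
    using assms unfolding orbit_graph_def by blast
  have box': "cx (\<sigma> t) \<in> {x0..x3} \<and> \<bar>cy (\<sigma> t)\<bar> \<le> 1" if "t \<in> {a..b}" for t
    using box[OF that] xs_order by auto
  show ?thesis
  proof (rule that[OF * box])
    fix s t assume st: "a \<le> s" "s < t" "t \<le> b"
    have "c * (t - s) \<le> cx (\<sigma> t) - cx (\<sigma> s)"
      by (rule solution_in_box(1)[OF *(2) box']) (use st in auto)
    moreover have "0 < c * (t - s)" using st strip_bounds by simp
    ultimately show "cx (\<sigma> s) < cx (\<sigma> t)" by linarith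
  next
    fix x assume x: "x \<in> {x1..x2}"
    have "continuous_on {a..b} (\<lambda>t. cx (\<sigma> t))"
      using *(2) by (auto simp: ode_solution_def intro!: continuous_on_vector_derivative coordinates_derivative)
    then obtain t where t: "t \<in> {a..b}" "cx (\<sigma> t) = x"
      using IVT'[of "\<lambda>t. cx (\<sigma> t)" a x b] * x by auto
    then show "\<exists>t\<in>{a..b}. \<sigma> t = H x (v x)" using box[OF t(1)] by (metis H_cx_cy)
  qed
qed

lemma orbit_graph_slope:
  assumes v: "orbit_graph v" and x: "x1 \<le> x" "x \<le> x'" "x' \<le> x2"
  shows "\<And>k. (\<And>s y. s \<in> {x1..x2} \<Longrightarrow> y = v s \<Longrightarrow> \<bar>y\<bar> \<le> 1 \<Longrightarrow> k * Lx (h (H s y)) \<le> Ly (h (H s y))) \<Longrightarrow>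
            k * (x' - x) \<le> v x' - v x"
    and "\<And>k. (\<And>s y. s \<in> {x1..x2} \<Longrightarrow> y = v s \<Longrightarrow> \<bar>y\<bar> \<le> 1 \<Longrightarrow> Ly (h (H s y)) \<le> k * Lx (h (H s y))) \<Longrightarrow>
            v x' - v x \<le> k * (x' - x)"
proof -
  obtain a b \<sigma> where *: "a \<le> b" "ode_solution h X {a..b} \<sigma>" "cx (\<sigma> a) = x1" "cx (\<sigma> b) = x2"
    and box: "\<And>t. t \<in> {a..b} \<Longrightarrow> cx (\<sigma> t) \<in> {x1..x2} \<and> \<bar>cy (\<sigma> t)\<bar> \<le> 1 \<and> v (cx (\<sigma> t)) = cy (\<sigma> t)"
    and mono: "\<And>s t. a \<le> s \<Longrightarrow> s < t \<Longrightarrow> t \<le> b \<Longrightarrow> cx (\<sigma> s) < cx (\<sigma> t)"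
    and surj: "\<And>x. x \<in> {x1..x2} \<Longrightarrow> \<exists>t\<in>{a..b}. \<sigma> t = H x (v x)"
    by (rule orbit_graph_param[OF v], rule that) blast+
  obtain t t' where t: "t \<in> {a..b}" "\<sigma> t = H x (v x)" "t' \<in> {a..b}" "\<sigma> t' = H x' (v x')"
    using surj[of x] surj[of x'] x by auto
  have tt: "t \<le> t'" using mono[of t' t] t x by force
  have box': "cx (\<sigma> t) \<in> {x0..x3} \<and> \<bar>cy (\<sigma> t)\<bar> \<le> 1" if "t \<in> {a..b}" for t
    using box[OF that] xs_order by auto
  have pt: "\<exists>s. s \<in> {x1..x2} \<and> z = H s (v s) \<and> \<bar>v s\<bar> \<le> 1" if "z \<in> \<sigma> ` {a..b}" for z
    using that box by (metis H_cx_cy imageE)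
  show "k * (x' - x) \<le> v x' - v x"
    if "\<And>s y. s \<in> {x1..x2} \<Longrightarrow> y = v s \<Longrightarrow> \<bar>y\<bar> \<le> 1 \<Longrightarrow> k * Lx (h (H s y)) \<le> Ly (h (H s y))" for k
  proof -
    have "k * Lx (h z) \<le> Ly (h z)" if "z \<in> \<sigma> ` {a..b}" for z
      using pt[OF that] \<open>\<And>s y. _ \<Longrightarrow> _ \<Longrightarrow> _ \<Longrightarrow> k * Lx (h (H s y)) \<le> Ly (h (H s y))\<close> by blast
    then show ?thesis
      using solution_in_box(2)[OF *(2) box', of t t' k] t tt by simp
  qed
  show "v x' - v x \<le> k * (x' - x)"
    if "\<And>s y. s \<in> {x1..x2} \<Longrightarrow> y = v s \<Longrightarrow> \<bar>y\<bar> \<le> 1 \<Longrightarrow> Ly (h (H s y)) \<le> k * Lx (h (H s y))" for k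
  proof -
    have "Ly (h z) \<le> k * Lx (h z)" if "z \<in> \<sigma> ` {a..b}" for z
      using pt[OF that] \<open>\<And>s y. _ \<Longrightarrow> _ \<Longrightarrow> _ \<Longrightarrow> Ly (h (H s y)) \<le> k * Lx (h (H s y))\<close> by blast
    then show ?thesis
      using solution_in_box(3)[OF *(2) box', of t t' k] t tt by simp
  qed
qed

lemma orbit_graph_Lipschitz:
  assumes v: "orbit_graph v" and x: "x \<in> {x1..x2}" "x' \<in> {x1..x2}"
  shows "\<bar>v x' - v x\<bar> \<le> M * \<bar>x' - x\<bar>"
proof -
  have *: "\<bar>v b - v a\<bar> \<le> M * (b - a)" if "x1 \<le> a" "a \<le> b" "b \<le> x2" for a b
  proof -
    have sp: "\<bar>Ly (h (H s y))\<bar> \<le> M * Lx (h (H s y))" if "s \<in> {x1..x2}" "\<bar>y\<bar> \<le> 1" for s y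
      using speed[of "H s y"] that xs_order by auto
    have "- M * (b - a) \<le> v b - v a"
      by (rule orbit_graph_slope(1)[OF v that]) (use sp in force)
    moreover have "v b - v a \<le> M * (b - a)"
      by (rule orbit_graph_slope(2)[OF v that]) (use sp in force)
    ultimately show ?thesis by auto
  qed
  show ?thesis using *[of x x'] *[of x' x] x by (cases "x \<le> x'") (auto simp: abs_minus_commute)
qed

lemma orbit_graph_continuous: "orbit_graph v \<Longrightarrow> continuous_on {x1..x2} v"
  by (rule lipschitz_on_continuous_on[of M])
    (use strip_bounds orbit_graph_Lipschitz in \<open>auto simp: lipschitz_on_def dist_real_def abs_minus_commute\<close>)

text \<open>The 1/8 stems from \<open>strip_bounds\<close>. A graph starting at height 1/4 or -1/4
  thus keeps distance 1/8 from the axis, and graphs starting within 1/4 stay within 1/2, where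
  \<open>orbit_graph_exists\<close> applies.\<close>

lemma orbit_graph_variation:
  assumes "orbit_graph v" and "x \<in> {x1..x2}" "x' \<in> {x1..x2}"
  shows "\<bar>v x' - v x\<bar> \<le> 1/8"
proof -
  have "M * \<bar>x' - x\<bar> \<le> M * (x3 - x0)" using assms xs_order strip_bounds by (intro mult_left_mono) auto
  then show ?thesis using orbit_graph_Lipschitz[OF assms] strip_bounds by linarith
qed

text \<open>With time shifted to 0 at the common point, both parametrizations solve the same initial
  value problem and agree on the common time interval. Strict monotonicity then identifies the
  intervals.\<close>

lemma orbit_graph_unique:
  assumes v: "orbit_graph v" "orbit_graph w" and x: "x \<in> {x1..x2}" "v x = w x" and y: "y \<in> {x1..x2}"
  shows "v y = w y"
proof -
  obtain a b \<sigma> where *: "a \<le> b" "ode_solution h X {a..b} \<sigma>" "cx (\<sigma> a) = x1" "cx (\<sigma> b) = x2"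
    and box: "\<And>t. t \<in> {a..b} \<Longrightarrow> cx (\<sigma> t) \<in> {x1..x2} \<and> \<bar>cy (\<sigma> t)\<bar> \<le> 1 \<and> v (cx (\<sigma> t)) = cy (\<sigma> t)"
    and mono: "\<And>s t. a \<le> s \<Longrightarrow> s < t \<Longrightarrow> t \<le> b \<Longrightarrow> cx (\<sigma> s) < cx (\<sigma> t)"
    and surj: "\<And>x. x \<in> {x1..x2} \<Longrightarrow> \<exists>t\<in>{a..b}. \<sigma> t = H x (v x)"
    by (rule orbit_graph_param[OF v(1)], rule that) blast+
  obtain a' b' \<sigma>' where orb': "a' \<le> b'" "ode_solution h X {a'..b'} \<sigma>'" "cx (\<sigma>' a') = x1" "cx (\<sigma>' b') = x2"
    and box': "\<And>t. t \<in> {a'..b'} \<Longrightarrow> cx (\<sigma>' t) \<in> {x1..x2} \<and> \<bar>cy (\<sigma>' t)\<bar> \<le> 1 \<and> w (cx (\<sigma>' t)) = cy (\<sigma>' t)"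
    and mono': "\<And>s t. a' \<le> s \<Longrightarrow> s < t \<Longrightarrow> t \<le> b' \<Longrightarrow> cx (\<sigma>' s) < cx (\<sigma>' t)"
    and surj': "\<And>x. x \<in> {x1..x2} \<Longrightarrow> \<exists>t\<in>{a'..b'}. \<sigma>' t = H x (w x)"
    by (rule orbit_graph_param[OF v(2)], rule that) blast+
  obtain r r' where r: "r \<in> {a..b}" "\<sigma> r = H x (v x)" "r' \<in> {a'..b'}" "\<sigma>' r' = H x (w x)"
    using surj surj' x by metis
  have agree: "\<sigma> (s + r) = \<sigma>' (s + r')" if "s + r \<in> {a..b}" "s + r' \<in> {a'..b'}" for s
    using unique[unfolded unique_solutions_def, rule_format,
        of "{a - r..b - r}" "\<lambda>t. \<sigma> (t + r)" "{a' - r'..b' - r'}" "\<lambda>t. \<sigma>' (t + r')" s]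
      ode_solution_shift[OF *(2), of r] ode_solution_shift[OF orb'(2), of r'] r x that by auto
  obtain t where t: "t \<in> {a..b}" "\<sigma> t = H y (v y)" using surj[OF y] by blast
  \<comment> \<open>If one solution started earlier, then at the starting time of the other it would
    already have passed \<open>x1\<close>, although both are at the same point.\<close>
  have "a - r = a' - r'"
  proof (rule ccontr)
    assume "a - r \<noteq> a' - r'"
    then consider "a - r < a' - r'" | "a' - r' < a - r" by linarith
    then show False
    proof cases
      case 1
      then show False using agree[of "a' - r'"] mono[of a "a' - r' + r"] r * orb' by auto
    next
      case 2
      then show False using agree[of "a - r"] mono'[of a' "a - r + r'"] r * orb' by auto
    qed
  qed
  moreover have "b - r = b' - r'"
  proof (rule ccontr)
    assume "b - r \<noteq> b' - r'"
    then consider "b - r < b' - r'" | "b' - r' < b - r" by linarith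
    then show False
    proof cases
      case 1
      then show False using agree[of "b - r"] mono'[of "b - r + r'" b'] r * orb' by auto
    next
      case 2
      then show False using agree[of "b' - r'"] mono[of "b' - r' + r" b] r * orb' by auto
    qed
  qed
  ultimately have t': "t - r + r' \<in> {a'..b'}" using t(1) by auto
  then have "\<sigma>' (t - r + r') = H y (v y)" using agree[of "t - r"] t by simp
  then show ?thesis using box'[OF t'] by simp
qed

text \<open>Orbits of one field do not cross: a change of order would give a zero of
  \<open>v - w\<close>, and then the graphs coincide.\<close>

lemma orbit_graph_le:
  assumes v: "orbit_graph v" "orbit_graph w" and x: "x \<in> {x1..x2}" "v x \<le> w x" and y: "y \<in> {x1..x2}"
  shows "v y \<le> w y"
proof (rule ccontr)
  assume n: "\<not> v y \<le> w y"
  have c: "continuous_on {x1..x2} (\<lambda>t. v t - w t)"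
    using v by (intro continuous_intros orbit_graph_continuous)
  have conn: "connected ((\<lambda>t. v t - w t) ` {x1..x2})"
    by (rule connected_continuous_image[OF c]) simp
  have "0 \<in> (\<lambda>t. v t - w t) ` {x1..x2}"
    by (rule connectedD_interval[OF conn imageI[OF x(1)] imageI[OF y]]) (use x n in auto)
  then show False using orbit_graph_unique[OF v _ _ y] n by force
qed

lemma orbit_graph_less:
  assumes v: "orbit_graph v" "orbit_graph w" and x: "x \<in> {x1..x2}" "v x < w x" and y: "y \<in> {x1..x2}"
  shows "v y < w y"
  using orbit_graph_le[OF v(2,1) y _ x(1)] x by linarith

text \<open>The solution through the point is followed to both ends of the strip. The margins
  \<open>x0 < x1\<close> and \<open>x2 < x3\<close> make the start strictly interior on the rear
  side in either direction of time.\<close>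

lemma orbit_graph_exists:
  assumes x: "x \<in> {x1..x2}" and y: "\<bar>y\<bar> \<le> 1/2"
  obtains v where "orbit_graph v" "v x = y"
proof -
  let ?z = "H x y"
  obtain \<sigma> where \<sigma>: "\<sigma> 0 = ?z" and sol: "ode_solution h X {-E..E} \<sigma>"
    using solvable[of ?z] x y xs_order by auto
  have d: "((\<lambda>t. cx (\<sigma> t)) has_vector_derivative Lx (h (\<sigma> t))) (at t within {-E..E})"
    "((\<lambda>t. cy (\<sigma> t)) has_vector_derivative Ly (h (\<sigma> t))) (at t within {-E..E})" if "t \<in> {-E..E}" for t
    using sol that by (auto simp: ode_solution_def intro!: coordinates_derivative)
  have sp: "c \<le> Lx (h (\<sigma> t)) \<and> \<bar>Ly (h (\<sigma> t))\<bar> \<le> M * Lx (h (\<sigma> t))"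
    if "cx (\<sigma> t) \<in> {x0..x3}" "\<bar>cy (\<sigma> t)\<bar> \<le> 1" for t
    using speed that by blast
  have m: "M * (x2 - x0) < 1/2" "M * (x3 - x1) < 1/2" "x2 - x0 < c * E" "x3 - x1 < c * E"
  proof -
    have "M * (x2 - x0) \<le> M * (x3 - x0)" "M * (x3 - x1) \<le> M * (x3 - x0)"
      using xs_order strip_bounds by (auto intro!: mult_left_mono)
    then show "M * (x2 - x0) < 1/2" "M * (x3 - x1) < 1/2" using strip_bounds by auto
  qed (use xs_order strip_bounds in auto)
  have "\<exists>T\<in>{0..E}. cx (\<sigma> T) = x2 \<and> (\<forall>t\<in>{0..T}. cx (\<sigma> t) \<in> {cx (\<sigma> 0)..x2} \<and> \<bar>cy (\<sigma> t)\<bar> \<le> 1)"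
  proof (rule reaches_right_end)
    show "((\<lambda>t. cx (\<sigma> t)) has_vector_derivative Lx (h (\<sigma> t))) (at t within {0..E})"
      "((\<lambda>t. cy (\<sigma> t)) has_vector_derivative Ly (h (\<sigma> t))) (at t within {0..E})" if "t \<in> {0..E}" for t
      using that d[of t] by (auto intro: has_vector_derivative_within_subset)
    show "c \<le> Lx (h (\<sigma> t)) \<and> \<bar>Ly (h (\<sigma> t))\<bar> \<le> M * Lx (h (\<sigma> t))"
      if "cx (\<sigma> t) \<in> {x0..x2}" "\<bar>cy (\<sigma> t)\<bar> \<le> 1" for t
      using that xs_order by (intro sp) auto
  qed (use strip_bounds xs_order x y \<sigma> m in auto)
  then obtain T where T: "T \<in> {0..E}" "cx (\<sigma> T) = x2"
    and boxT: "\<And>t. t \<in> {0..T} \<Longrightarrow> cx (\<sigma> t) \<in> {x..x2} \<and> \<bar>cy (\<sigma> t)\<bar> \<le> 1"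
    using \<sigma> by auto
  \<comment> \<open>Backwards in time the first coordinate is reflected, so that the motion is again
    to the right, from above \<open>- x3\<close> to \<open>- x1\<close>.\<close>
  have "\<exists>T\<in>{0..E}. - cx (\<sigma> (- T)) = - x1 \<and>
      (\<forall>t\<in>{0..T}. - cx (\<sigma> (- t)) \<in> {- cx (\<sigma> (- 0))..- x1} \<and> \<bar>cy (\<sigma> (- t))\<bar> \<le> 1)"
  proof (rule reaches_right_end)
    fix t assume t: "t \<in> {0..E}"
    have chain: "((\<lambda>t. k (- t)) has_vector_derivative - k') (at t within {0..E})"
      if "(k has_vector_derivative k') (at (- t) within {-E..E})" for k :: "real \<Rightarrow> real" and k'
    proof -
      have "(k has_vector_derivative k') (at (- t) within uminus ` {0..E})"
        by (rule has_vector_derivative_within_subset[OF that]) auto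
      moreover have "(uminus has_vector_derivative (-1::real)) (at t within {0..E})"
        by (auto intro!: derivative_eq_intros)
      ultimately show ?thesis
        using vector_diff_chain_within[of uminus "-1" t "{0..E}" k k'] by (simp add: o_def)
    qed
    show "((\<lambda>t. - cx (\<sigma> (- t))) has_vector_derivative Lx (h (\<sigma> (- t)))) (at t within {0..E})"
      using has_vector_derivative_minus[OF chain[OF d(1)]] t by auto
    show "((\<lambda>t. cy (\<sigma> (- t))) has_vector_derivative - Ly (h (\<sigma> (- t)))) (at t within {0..E})"
      using chain[OF d(2)] t by auto
    show "c \<le> Lx (h (\<sigma> (- t))) \<and> \<bar>- Ly (h (\<sigma> (- t)))\<bar> \<le> M * Lx (h (\<sigma> (- t)))"
      if "- cx (\<sigma> (- t)) \<in> {- x3..- x1}" "\<bar>cy (\<sigma> (- t))\<bar> \<le> 1"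
      using that xs_order sp[of "- t"] by auto
  qed (use strip_bounds xs_order x y \<sigma> m in auto)
  then obtain T' where T': "T' \<in> {0..E}" "cx (\<sigma> (- T')) = x1"
    and boxT': "\<And>t. t \<in> {0..T'} \<Longrightarrow> cx (\<sigma> (- t)) \<in> {x1..x} \<and> \<bar>cy (\<sigma> (- t))\<bar> \<le> 1"
    using \<sigma> by fastforce
  have box: "cx (\<sigma> t) \<in> {x1..x2} \<and> \<bar>cy (\<sigma> t)\<bar> \<le> 1" if "t \<in> {- T'..T}" for t
    using boxT[of t] boxT'[of "- t"] that x by (cases "0 \<le> t") auto
  have sol': "ode_solution h X {- T'..T} \<sigma>"
    by (rule ode_solution_subinterval[OF sol]) (use T T' sol in \<open>auto simp: ode_solution_def\<close>)
  have mono: "cx (\<sigma> s) < cx (\<sigma> t)" if "- T' \<le> s" "s < t" "t \<le> T" for s t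
  proof -
    have "c * (t - s) \<le> cx (\<sigma> t) - cx (\<sigma> s)"
      by (rule solution_in_box(1)[OF sol']) (use box xs_order that in force)+
    moreover have "0 < c * (t - s)" using that strip_bounds by simp
    ultimately show ?thesis by linarith
  qed
  have inj: "inj_on (\<lambda>t. cx (\<sigma> t)) {- T'..T}"
    by (rule inj_onI) (metis atLeastAtMost_iff linorder_neqE_linordered_idom mono order_less_irrefl)
  \<comment> \<open>The first coordinate serves as the new parameter in place of time.\<close>
  define v where "v s = cy (\<sigma> (inv_into {- T'..T} (\<lambda>t. cx (\<sigma> t)) s))" for s
  have v: "v (cx (\<sigma> t)) = cy (\<sigma> t)" if "t \<in> {- T'..T}" for t
    using inv_into_f_f[OF inj that] by (simp add: v_def)
  show ?thesis
  proof
    show "orbit_graph v"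
      unfolding orbit_graph_def
      by (rule exI[of _ "- T'"], rule exI[of _ T], rule exI[of _ \<sigma>]) (use T T' sol' box v in auto)
    show "v x = y" using v[of 0] \<sigma> T T' by simp
  qed
qed

text \<open>A piece of the graph is traversed rightwards by \<open>h\<close> and leftwards by
  \<open>- h\<close>; the two conclusions serve the two fields of the system.\<close>

lemma orbit_graph_arc:
  assumes v: "orbit_graph v" and x: "x1 \<le> x" "x < x'" "x' \<le> x2"
    and S: "\<And>s. s \<in> {x..x'} \<Longrightarrow> H s (v s) \<in> S"
  shows "h \<in> Fs \<Longrightarrow> arc_of Fs S (H x (v x)) (H x' (v x'))"
    and "(\<lambda>z. - h z) \<in> Fs \<Longrightarrow> arc_of Fs S (H x' (v x')) (H x (v x))"
proof -
  obtain a b \<sigma> where *: "a \<le> b" "ode_solution h X {a..b} \<sigma>" "cx (\<sigma> a) = x1" "cx (\<sigma> b) = x2"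
    and box: "\<And>t. t \<in> {a..b} \<Longrightarrow> cx (\<sigma> t) \<in> {x1..x2} \<and> \<bar>cy (\<sigma> t)\<bar> \<le> 1 \<and> v (cx (\<sigma> t)) = cy (\<sigma> t)"
    and mono: "\<And>s t. a \<le> s \<Longrightarrow> s < t \<Longrightarrow> t \<le> b \<Longrightarrow> cx (\<sigma> s) < cx (\<sigma> t)"
    and surj: "\<And>x. x \<in> {x1..x2} \<Longrightarrow> \<exists>t\<in>{a..b}. \<sigma> t = H x (v x)"
    by (rule orbit_graph_param[OF v], rule that) blast+
  obtain t t' where t: "t \<in> {a..b}" "\<sigma> t = H x (v x)" "t' \<in> {a..b}" "\<sigma> t' = H x' (v x')"
    using surj[of x] surj[of x'] x by auto
  have tt: "t < t'"
  proof (rule ccontr)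
    assume "\<not> t < t'"
    then show False using mono[of t' t] t x by (cases "t = t'") auto
  qed
  have "\<sigma> r \<in> S" if r: "r \<in> {t..t'}" for r
  proof -
    have "x \<le> cx (\<sigma> r)" using mono[of t r] t r by (cases "t = r") auto
    moreover have "cx (\<sigma> r) \<le> x'" using mono[of r t'] t r by (cases "t' = r") auto
    ultimately show ?thesis
      using S[of "cx (\<sigma> r)"] box[of r] t r by auto
  qed
  then have sol: "ode_solution h S {t..t'} \<sigma>"
    by (intro ode_solution_subinterval[OF *(2)]) (use t in auto)
  show "arc_of Fs S (H x (v x)) (H x' (v x'))" if "h \<in> Fs"
    unfolding arc_of_def using ode_solution_shift[OF sol, of t] t tt
    by (intro bexI[OF _ that] exI[of _ "\<lambda>s. \<sigma> (s + t)"] exI[of _ "t' - t"]) auto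
  show "arc_of Fs S (H x' (v x')) (H x (v x))" if "(\<lambda>z. - h z) \<in> Fs"
  proof -
    have "ode_solution (\<lambda>z. - h z) S {- t'..- t} (\<lambda>s. \<sigma> (- s))"
      using ode_solution_reverse[OF sol] by simp
    from ode_solution_shift[OF this, of "- t'"] show ?thesis
      unfolding arc_of_def using t tt
      by (intro bexI[OF _ that] exI[of _ "\<lambda>s. \<sigma> (- (s + - t'))"] exI[of _ "t' - t"]) auto
  qed
qed

end

section \<open>The region between two orbits with common end points\<close>

text \<open>The greatest point with \<open>\<phi> \<le> 0\<close>; by the intermediate value theorem
  \<open>\<phi>\<close> vanishes there. Applied to differences of graphs, it finds where they last
  met.\<close>

lemma last_zero:
  fixes \<phi> :: "real \<Rightarrow> real"
  assumes cont: "continuous_on {c..d} \<phi>" and "c \<le> d" "\<phi> c \<le> 0" "0 \<le> \<phi> d"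
  obtains r where "r \<in> {c..d}" "\<phi> r = 0" "\<And>t. t \<in> {r..d} \<Longrightarrow> 0 \<le> \<phi> t"
proof -
  let ?C = "{c..d} \<inter> \<phi> -` {..0}"
  have "compact ?C"
    by (auto simp: compact_eq_bounded_closed intro!: continuous_closed_preimage cont
        bounded_subset[OF bounded_closed_interval[of c d]])
  moreover have "c \<in> ?C" using assms by simp
  ultimately obtain r where r: "r \<in> {c..d}" "\<phi> r \<le> 0" and max: "\<And>t. t \<in> ?C \<Longrightarrow> t \<le> r"
    using compact_attains_sup[of ?C] by blast
  have "continuous_on {r..d} \<phi>" by (rule continuous_on_subset[OF cont]) (use r in auto)
  then obtain s where s: "r \<le> s" "s \<le> d" "\<phi> s = 0" using IVT'[of \<phi> r 0 d] r assms by auto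
  then have "s = r" using max[of s] r by force
  moreover have "0 \<le> \<phi> t" if "t \<in> {r..d}" for t
    using max[of t] that r s \<open>s = r\<close> by (cases "\<phi> t \<le> 0") auto
  ultimately show ?thesis using that r s by blast
qed

lemma first_zero:
  fixes \<phi> :: "real \<Rightarrow> real"
  assumes cont: "continuous_on {c..d} \<phi>" and "c \<le> d" "0 \<le> \<phi> c" "\<phi> d \<le> 0"
  obtains r where "r \<in> {c..d}" "\<phi> r = 0" "\<And>t. t \<in> {c..r} \<Longrightarrow> 0 \<le> \<phi> t"
proof -
  have c: "continuous_on {- d..- c} (\<lambda>t. \<phi> (- t))"
    by (rule continuous_on_compose2[OF cont]) (auto intro!: continuous_intros)
  obtain r where r: "r \<in> {- d..- c}" "\<phi> (- r) = 0" "\<And>t. t \<in> {r..- c} \<Longrightarrow> 0 \<le> \<phi> (- t)"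
    using last_zero[OF c] assms by auto
  show ?thesis
  proof (rule that[of "- r"])
    show "0 \<le> \<phi> t" if "t \<in> {c..- r}" for t using r(3)[of "- t"] that by simp
  qed (use r in auto)
qed

text \<open>
  Both fields point to the right here. In the application the system consists of \<open>hQ\<close> and \<open>- hP\<close>, so
  graphs of \<open>hQ\<close> are traversed from left to right and graphs of \<open>hP\<close> from right to left.
\<close>

locale two_fields =
  Q: strip_field xs e e' Lx Ly x0 x1 x2 x3 c M E X hQ +
  P: strip_field xs e e' Lx Ly x0 x1 x2 x3 c M E X hP
  for xs e e' :: "'a::euclidean_space" and Lx Ly x0 x1 x2 x3 c M E X hQ hP
begin

text \<open>Graphs of both fields with a common left end are compared at \<open>x2\<close>. From
  height 1/4 the graph of \<open>hP\<close> stays above 1/8, falls at slope at most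
  \<open>- l\<close> and ends below that of \<open>hQ\<close>, whose slope is at most
  \<open>k < l\<close> in absolute value; from -1/4 it ends above. In between the right ends agree
  for some height.\<close>

lemma common_end_points:
  assumes flat: "0 \<le> k" "k < l"
      "\<And>z. Q.cx z \<in> {x0..x3} \<Longrightarrow> \<bar>Q.cy z\<bar> \<le> 1 \<Longrightarrow> \<bar>Ly (hQ z)\<bar> \<le> k * Lx (hQ z)"
    and top: "\<And>z. Q.cx z \<in> {x0..x3} \<Longrightarrow> 1/8 \<le> Q.cy z \<Longrightarrow> Q.cy z \<le> 1 \<Longrightarrow> Ly (hP z) \<le> - l * Lx (hP z)"
    and bottom: "\<And>z. Q.cx z \<in> {x0..x3} \<Longrightarrow> - 1 \<le> Q.cy z \<Longrightarrow> Q.cy z \<le> - 1/8 \<Longrightarrow> l * Lx (hP z) \<le> Ly (hP z)"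
  obtains u w where "Q.orbit_graph u" "P.orbit_graph w" "u x1 = w x1" "u x2 = w x2" "\<bar>u x1\<bar> \<le> 1/4"
proof -
  note xs_order = Q.xs_order
  have mem: "x1 \<in> {x1..x2}" "x2 \<in> {x1..x2}" using xs_order by auto
  have Qslope: "\<bar>u x2 - u x1\<bar> \<le> k * (x2 - x1)" if u: "Q.orbit_graph u" for u
  proof -
    have sl: "- k * Lx (hQ (Q.H s y)) \<le> Ly (hQ (Q.H s y)) \<and> Ly (hQ (Q.H s y)) \<le> k * Lx (hQ (Q.H s y))"
      if "s \<in> {x1..x2}" "\<bar>y\<bar> \<le> 1" for s y
      using flat(3)[of "Q.H s y"] that xs_order by (auto simp: abs_le_iff)
    have "- k * (x2 - x1) \<le> u x2 - u x1"
      by (rule Q.orbit_graph_slope(1)[OF u]) (use sl xs_order in auto)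
    moreover have "u x2 - u x1 \<le> k * (x2 - x1)"
      by (rule Q.orbit_graph_slope(2)[OF u]) (use sl xs_order in auto)
    ultimately show ?thesis by auto
  qed
  have kl: "k * (x2 - x1) < l * (x2 - x1)" using flat xs_order by simp
  have above: "w x2 < u x2" if u: "Q.orbit_graph u" and w: "P.orbit_graph w" and "u x1 = 1/4" "w x1 = 1/4" for u w
  proof -
    have "1/8 \<le> w s" if "s \<in> {x1..x2}" for s
      using P.orbit_graph_variation[OF w mem(1) that] \<open>w x1 = 1/4\<close> by linarith
    then have "w x2 - w x1 \<le> - l * (x2 - x1)"
      by (intro P.orbit_graph_slope(2)[OF w] top) (use xs_order in auto)
    then show ?thesis using Qslope[OF u] kl that by (auto simp: abs_le_iff)
  qed
  have below: "u x2 < w x2" if u: "Q.orbit_graph u" and w: "P.orbit_graph w" and "u x1 = - 1/4" "w x1 = - 1/4" for u w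
  proof -
    have "w s \<le> - 1/8" if "s \<in> {x1..x2}" for s
      using P.orbit_graph_variation[OF w mem(1) that] \<open>w x1 = - 1/4\<close> by linarith
    then have "l * (x2 - x1) \<le> w x2 - w x1"
      by (intro P.orbit_graph_slope(1)[OF w] bottom) (use xs_order in auto)
    then show ?thesis using Qslope[OF u] kl that by (auto simp: abs_le_iff)
  qed
  \<comment> \<open>No continuous dependence on the initial value is used: at the supremum of \<open>S\<close> a strict
    inequality between the right end points is refuted by the graph through their midpoint.\<close>
  define S where "S = {y \<in> {- 1/4..1/4}. \<exists>u w. Q.orbit_graph u \<and> P.orbit_graph w \<and> u x1 = y \<and> w x1 = y \<and> u x2 \<le> w x2}"
  have pair: "\<exists>u w. Q.orbit_graph u \<and> P.orbit_graph w \<and> u x1 = y \<and> w x1 = y" if "\<bar>y\<bar> \<le> 1/4" for y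
  proof -
    have y: "\<bar>y\<bar> \<le> 1/2" using that by linarith
    show ?thesis using Q.orbit_graph_exists[OF mem(1) y] P.orbit_graph_exists[OF mem(1) y] by metis
  qed
  have "- 1/4 \<in> S"
  proof -
    obtain u w where "Q.orbit_graph u" "P.orbit_graph w" "u x1 = - 1/4" "w x1 = - 1/4"
      using pair[of "- 1/4"] by auto
    moreover from this have "u x2 \<le> w x2" by (intro less_imp_le below)
    ultimately show ?thesis unfolding S_def by (intro CollectI conjI exI[of _ u] exI[of _ w]) simp_all
  qed
  have "S \<subseteq> {- 1/4..1/4}" by (auto simp: S_def)
  then have "bdd_above S" by (rule bdd_above_mono[OF bdd_above_Icc])
  with \<open>- 1/4 \<in> S\<close> have S: "S \<noteq> {}" "bdd_above S" by blast+
  define y where "y = Sup S"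
  have "- 1/4 \<le> y" unfolding y_def by (rule cSup_upper[OF \<open>- 1/4 \<in> S\<close> S(2)])
  moreover have "y \<le> 1/4" unfolding y_def by (rule cSup_least[OF S(1)]) (auto simp: S_def)
  ultimately have y: "\<bar>y\<bar> \<le> 1/4" by auto
  obtain u w where u: "Q.orbit_graph u" "u x1 = y" and w: "P.orbit_graph w" "w x1 = y" using pair[OF y] by blast
  have u2: "\<bar>u x2\<bar> \<le> 3/8" using Q.orbit_graph_variation[OF u(1) mem] u(2) y by linarith
  have w2: "\<bar>w x2\<bar> \<le> 3/8" using P.orbit_graph_variation[OF w(1) mem] w(2) y by linarith
  define m where "m = (u x2 + w x2) / 2"
  have "\<bar>m\<bar> \<le> 1/2" using u2 w2 unfolding m_def abs_le_iff by auto
  then obtain u' where u': "Q.orbit_graph u'" "u' x2 = m"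
    using Q.orbit_graph_exists[OF mem(2)] by blast
  have "\<not> u x2 < w x2"
  proof
    assume *: "u x2 < w x2"
    then have "y \<noteq> 1/4" using above[OF u(1) w(1)] u w by auto
    moreover have "y < u' x1"
      using Q.orbit_graph_less[OF u(1) u'(1) mem(2) _ mem(1)] * u u' by (simp add: m_def)
    ultimately have lt: "y < min (u' x1) (1/4)" using y by (auto simp: abs_le_iff)
    have "\<bar>min (u' x1) (1/4)\<bar> \<le> 1/4" using lt y by (auto simp: abs_le_iff)
    then obtain u'' w'' where u'': "Q.orbit_graph u''" "u'' x1 = min (u' x1) (1/4)"
      and w'': "P.orbit_graph w''" "w'' x1 = min (u' x1) (1/4)" using pair by blast
    have "u'' x2 \<le> m" using Q.orbit_graph_le[OF u''(1) u'(1) mem(1) _ mem(2)] u'' u' by simp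
    moreover have "w x2 < w'' x2" using P.orbit_graph_less[OF w(1) w''(1) mem(1) _ mem(2)] w'' w lt by simp
    ultimately have "u'' x2 \<le> w'' x2" using * by (simp add: m_def)
    \<comment> \<open>A starting height above the supremum \<open>y\<close> would belong to
      \<open>S\<close>; the cap 1/4 keeps it in the admissible range.\<close>
    then have "min (u' x1) (1/4) \<in> S"
      using u'' w'' lt y unfolding S_def by (auto simp: abs_le_iff)
    then have "min (u' x1) (1/4) \<le> y" unfolding y_def by (rule cSup_upper[OF _ S(2)])
    then show False using lt by simp
  qed
  moreover have "\<not> w x2 < u x2"
  proof
    assume *: "w x2 < u x2"
    have "u' x1 < y"
      using Q.orbit_graph_less[OF u'(1) u(1) mem(2) _ mem(1)] * u u' by (simp add: m_def)
    \<comment> \<open>The graphs starting at height \<open>s\<close> yield the cycle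
      \<open>m < us x2 \<le> ws x2 \<le> w x2 < m\<close>.\<close>
    then obtain s where s: "s \<in> S" "u' x1 < s" unfolding y_def using less_cSup_iff[OF S] by blast
    have "s \<le> y" unfolding y_def by (rule cSup_upper[OF s(1) S(2)])
    obtain us ws where us: "Q.orbit_graph us" "us x1 = s" and ws: "P.orbit_graph ws" "ws x1 = s" and "us x2 \<le> ws x2"
      using s(1) unfolding S_def by blast
    moreover have "m < us x2" using Q.orbit_graph_less[OF u'(1) us(1) mem(1) _ mem(2)] us s u' by simp
    moreover have "ws x2 \<le> w x2" using P.orbit_graph_le[OF ws(1) w(1) mem(1) _ mem(2)] ws w \<open>s \<le> y\<close> by simp
    ultimately show False using * by (simp add: m_def)
  qed
  ultimately show ?thesis using that[OF u(1) w(1)] u w y by auto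
qed

section \<open>The region and its boundary\<close>

text \<open>Interpolation from \<open>w\<close> (parameter 0) to \<open>u\<close> (parameter 1)
  exhibits the region as a continuous image of a rectangle, hence compact, whichever graph is
  above.\<close>

definition between :: "(real \<Rightarrow> real) \<Rightarrow> (real \<Rightarrow> real) \<Rightarrow> real \<Rightarrow> real \<Rightarrow> 'a set" where
  "between u w a b = (\<lambda>(x, s). Q.H x (w x + s * (u x - w x))) ` ({a..b} \<times> {0..1})"

definition graph :: "(real \<Rightarrow> real) \<Rightarrow> real \<Rightarrow> real \<Rightarrow> 'a set" where
  "graph u a b = (\<lambda>x. Q.H x (u x)) ` {a..b}"

lemma compact_between:
  "continuous_on {a..b} u \<Longrightarrow> continuous_on {a..b} w \<Longrightarrow> compact (between u w a b)"
  unfolding between_def case_prod_beta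
  by (intro compact_continuous_image compact_Times compact_Icc Q.continuous_on_H continuous_intros
      continuous_on_compose2[of "{a..b}" u _ fst] continuous_on_compose2[of "{a..b}" w _ fst]) auto

lemma compact_graph: "continuous_on {a..b} u \<Longrightarrow> compact (graph u a b)"
  unfolding graph_def by (intro compact_continuous_image Q.continuous_on_H continuous_intros compact_Icc)

lemma graph_subset_between: "graph u a b \<subseteq> between u w a b" "graph w a b \<subseteq> between u w a b"
proof -
  have "Q.H x (u x) \<in> between u w a b" "Q.H x (w x) \<in> between u w a b" if "x \<in> {a..b}" for x
    unfolding between_def using that
    by (auto intro: image_eqI[of _ _ "(x, 1)"] image_eqI[of _ _ "(x, 0)"])
  then show "graph u a b \<subseteq> between u w a b" "graph w a b \<subseteq> between u w a b"
    by (auto simp: graph_def)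
qed

text \<open>The sign \<open>\<epsilon>\<close> records which graph is above, so that both cases
  share one description by inequalities.\<close>

lemma in_between_iff:
  assumes "\<forall>x\<in>{a..b}. 0 \<le> \<epsilon> * (u x - w x)" and "\<epsilon> \<in> {1, - 1 :: real}"
  shows "Q.H x y \<in> between u w a b \<longleftrightarrow> x \<in> {a..b} \<and> 0 \<le> \<epsilon> * (y - w x) \<and> 0 \<le> \<epsilon> * (u x - y)"
proof
  assume "Q.H x y \<in> between u w a b"
  then obtain s where s: "x \<in> {a..b}" "0 \<le> s" "s \<le> 1" and y: "y = w x + s * (u x - w x)"
    by (auto simp: between_def)
  have "\<epsilon> * (y - w x) = s * (\<epsilon> * (u x - w x))" "\<epsilon> * (u x - y) = (1 - s) * (\<epsilon> * (u x - w x))"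
    by (simp_all add: y algebra_simps)
  moreover have "0 \<le> s * (\<epsilon> * (u x - w x))" "0 \<le> (1 - s) * (\<epsilon> * (u x - w x))"
    using s assms(1) by (auto intro!: mult_nonneg_nonneg simp del: mult_eq_0_iff)
  ultimately show "x \<in> {a..b} \<and> 0 \<le> \<epsilon> * (y - w x) \<and> 0 \<le> \<epsilon> * (u x - y)"
    using s(1) by (simp only: simp_thms)
next
  assume *: "x \<in> {a..b} \<and> 0 \<le> \<epsilon> * (y - w x) \<and> 0 \<le> \<epsilon> * (u x - y)"
  \<comment> \<open>Where the graphs meet, division by zero gives 0, and this value is correct since
    then \<open>y = w x\<close>.\<close>
  define s where "s = (y - w x) / (u x - w x)"
  have "y = w x + s * (u x - w x) \<and> 0 \<le> s \<and> s \<le> 1"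
  proof (cases "u x = w x")
    case True
    then show ?thesis using * assms(2) by (auto simp: s_def)
  next
    case False
    then show ?thesis using * assms(2) by (auto simp: s_def divide_simps)
  qed
  then show "Q.H x y \<in> between u w a b" unfolding between_def using * by force
qed

text \<open>The reflexive closure admits \<open>x = x'\<close>, where no motion takes place and no
  arc exists.\<close>

lemma arcs_along_graph:
  assumes x: "x1 \<le> x" "x \<le> x'" "x' \<le> x2" and S: "\<And>s. s \<in> {x..x'} \<Longrightarrow> Q.H s (v s) \<in> S"
  shows "Q.orbit_graph v \<Longrightarrow> hQ \<in> Fs \<Longrightarrow> (arc_of Fs S)\<^sup>*\<^sup>* (Q.H x (v x)) (Q.H x' (v x'))"
    and "P.orbit_graph v \<Longrightarrow> (\<lambda>z. - hP z) \<in> Fs \<Longrightarrow> (arc_of Fs S)\<^sup>*\<^sup>* (Q.H x' (v x')) (Q.H x (v x))"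
proof -
  have "x = x' \<or> x < x'" using x by linarith
  then show "(arc_of Fs S)\<^sup>*\<^sup>* (Q.H x (v x)) (Q.H x' (v x'))" if "Q.orbit_graph v" "hQ \<in> Fs"
    using Q.orbit_graph_arc(1)[OF that(1) x(1) _ x(3) S that(2)] by (metis r_into_rtranclp rtranclp.rtrancl_refl)
  show "(arc_of Fs S)\<^sup>*\<^sup>* (Q.H x' (v x')) (Q.H x (v x))" if "P.orbit_graph v" "(\<lambda>z. - hP z) \<in> Fs"
    using \<open>x = x' \<or> x < x'\<close> P.orbit_graph_arc(2)[OF that(1) x(1) _ x(3) S that(2)]
    by (metis r_into_rtranclp rtranclp.rtrancl_refl)
qed

text \<open>The orbit of \<open>hP\<close> through a point of the region cannot cross
  \<open>w\<close>, an orbit of the same field. As \<open>u\<close> and \<open>w\<close> meet at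
  both ends, it must meet \<open>u\<close> on either side. The route from \<open>p\<close> is
  therefore: left to \<open>u\<close>, along \<open>u\<close> to \<open>b\<close>, back along
  \<open>w\<close> to \<open>a\<close>, along \<open>u\<close> again, and left to
  \<open>q\<close>.\<close>

lemma between_strongly_connected:
  assumes Fs: "hQ \<in> Fs" "(\<lambda>z. - hP z) \<in> Fs" and u: "Q.orbit_graph u" and w: "P.orbit_graph w"
    and ab: "x1 \<le> a" "a \<le> b" "b \<le> x2" "u a = w a" "u b = w b"
    and sgn: "\<forall>x\<in>{a..b}. 0 \<le> \<epsilon> * (u x - w x)" "\<epsilon> \<in> {1, - 1 :: real}"
    and small: "\<And>x. x \<in> {a..b} \<Longrightarrow> \<bar>u x\<bar> \<le> 1/2 \<and> \<bar>w x\<bar> \<le> 1/2"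
    and p: "p \<in> between u w a b" and q: "q \<in> between u w a b"
  shows "(arc_of Fs (between u w a b))\<^sup>*\<^sup>* p q"
proof -
  let ?V = "between u w a b"
  let ?R = "(arc_of Fs ?V)\<^sup>*\<^sup>*"
  note mem = in_between_iff[OF sgn]
  have uV: "Q.H x (u x) \<in> ?V" and wV: "Q.H x (w x) \<in> ?V" if "x \<in> {a..b}" for x
    using that graph_subset_between[of u a b w] graph_subset_between[of w a b u] by (auto simp: graph_def mem sgn)
  have along_u: "?R (Q.H x (u x)) (Q.H x' (u x'))" if "a \<le> x" "x \<le> x'" "x' \<le> b" for x x'
    using that ab uV by (intro arcs_along_graph(1)[OF _ _ _ _ u Fs(1)]) auto
  have along_w: "?R (Q.H x' (w x')) (Q.H x (w x))" if "a \<le> x" "x \<le> x'" "x' \<le> b" for x x'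
    using that ab wV by (intro arcs_along_graph(2)[OF _ _ _ _ w Fs(2)]) auto
  have exits: "(\<exists>r\<in>{a..b}. ?R z (Q.H r (u r))) \<and> (\<exists>r\<in>{a..b}. ?R (Q.H r (u r)) z)" if z: "z \<in> ?V" for z
  proof -
    define x y where "x = Q.cx z" and "y = Q.cy z"
    have zxy: "z = Q.H x y" by (simp add: x_def y_def)
    have xy: "x \<in> {a..b}" "0 \<le> \<epsilon> * (y - w x)" "0 \<le> \<epsilon> * (u x - y)" using z unfolding zxy mem by auto
    have "\<bar>y\<bar> \<le> 1/2" using xy small[OF xy(1)] sgn(2) by (auto simp: abs_le_iff)
    then obtain v where v: "P.orbit_graph v" "v x = y" using P.orbit_graph_exists[of x y] xy ab by auto
    have vw: "0 \<le> \<epsilon> * (v t - w t)" if "t \<in> {a..b}" for t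
      using P.orbit_graph_le[OF v(1) w, of x t] P.orbit_graph_le[OF w v(1), of x t] xy v sgn(2) that ab by auto
    let ?d = "\<lambda>t. \<epsilon> * (u t - v t)"
    have cd: "continuous_on {s..t} ?d" if "a \<le> s" "t \<le> b" for s t
      using that ab
      by (intro continuous_intros continuous_on_subset[OF Q.orbit_graph_continuous[OF u]]
          continuous_on_subset[OF P.orbit_graph_continuous[OF v(1)]]) auto
    \<comment> \<open>At \<open>a\<close> and \<open>b\<close> the graph \<open>u\<close> equals
      \<open>w\<close>, and \<open>v\<close> lies on the side of \<open>w\<close> given by
      \<open>vw\<close>. At \<open>x\<close> the sign of \<open>?d\<close> is opposite.\<close>
    have ends: "?d a \<le> 0" "?d b \<le> 0" using vw[of a] vw[of b] ab by (auto simp: algebra_simps)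
    obtain r where r: "r \<in> {a..x}" "?d r = 0" "\<And>t. t \<in> {r..x} \<Longrightarrow> 0 \<le> ?d t"
      using last_zero[OF cd[of a x]] xy ends v by auto
    obtain r' where r': "r' \<in> {x..b}" "?d r' = 0" "\<And>t. t \<in> {x..r'} \<Longrightarrow> 0 \<le> ?d t"
      using first_zero[OF cd[of x b]] xy ends v by auto
    have "v r = u r" "v r' = u r'" using r(2) r'(2) sgn(2) by auto
    moreover have "?R (Q.H x (v x)) (Q.H r (v r))"
      using r xy ab vw by (intro arcs_along_graph(2)[OF _ _ _ _ v(1) Fs(2)]) (auto simp: mem)
    moreover have "?R (Q.H r' (v r')) (Q.H x (v x))"
      using r' xy ab vw by (intro arcs_along_graph(2)[OF _ _ _ _ v(1) Fs(2)]) (auto simp: mem)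
    moreover have "r \<in> {a..b}" "r' \<in> {a..b}" using r r' xy by auto
    ultimately show ?thesis unfolding zxy v(2)[symmetric] by metis
  qed
  obtain r where r: "r \<in> {a..b}" "?R p (Q.H r (u r))" using exits[OF p] by blast
  obtain r' where r': "r' \<in> {a..b}" "?R (Q.H r' (u r')) q" using exits[OF q] by blast
  have "?R (Q.H r (u r)) (Q.H b (w b))" using along_u[of r b] r ab by auto
  moreover have "?R (Q.H b (w b)) (Q.H a (u a))" using along_w[of a b] ab by auto
  moreover have "?R (Q.H a (u a)) (Q.H r' (u r'))" using along_u[of a r'] r' by auto
  ultimately show ?thesis using r r' by (meson rtranclp_trans)
qed

lemma closed_orbit_polygon:
  assumes Fs: "hQ \<in> Fs" "(\<lambda>z. - hP z) \<in> Fs" and u: "Q.orbit_graph u" and w: "P.orbit_graph w"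
    and ab: "x1 \<le> a" "a < b" "b \<le> x2" "u a = w a" "u b = w b"
  shows "(arc_of Fs (graph u a b \<union> graph w a b))\<^sup>+\<^sup>+ (Q.H a (u a)) (Q.H b (u b))"
    and "(arc_of Fs (graph u a b \<union> graph w a b))\<^sup>+\<^sup>+ (Q.H b (u b)) (Q.H a (u a))"
proof -
  show "(arc_of Fs (graph u a b \<union> graph w a b))\<^sup>+\<^sup>+ (Q.H a (u a)) (Q.H b (u b))"
    by (intro tranclp.r_into_trancl Q.orbit_graph_arc(1)[OF u]) (use ab Fs in \<open>auto simp: graph_def\<close>)
  show "(arc_of Fs (graph u a b \<union> graph w a b))\<^sup>+\<^sup>+ (Q.H b (u b)) (Q.H a (u a))"
    unfolding ab(4,5)
    by (intro tranclp.r_into_trancl P.orbit_graph_arc(2)[OF w]) (use ab Fs in \<open>auto simp: graph_def\<close>)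
qed

text \<open>The region is taken over an interval on which \<open>u - w\<close> keeps its sign: all
  of \<open>{x1..x2}\<close> if the graphs coincide, otherwise an interval around a point where they
  differ, bounded by zeros of the difference.\<close>

lemma chaotic_set_between:
  assumes cont: "continuous_on X f" "continuous_on X g" and Fs: "hQ \<in> {f, g}" "(\<lambda>z. - hP z) \<in> {f, g}"
    and u: "Q.orbit_graph u" and w: "P.orbit_graph w"
    and ends: "u x1 = w x1" "u x2 = w x2" and small: "\<bar>u x1\<bar> \<le> 1/4"
  shows "\<exists>V. chaotic_set X (\<lambda>x. {f x, g x}) V"
proof -
  note xs_order = Q.xs_order
  have mem: "x1 \<in> {x1..x2}" using xs_order by auto
  have bound: "\<bar>u x\<bar> \<le> 1/2 \<and> \<bar>w x\<bar> \<le> 1/2" if "x \<in> {x1..x2}" for x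
    using Q.orbit_graph_variation[OF u mem that] P.orbit_graph_variation[OF w mem that] small ends(1)
    by (intro conjI; linarith)
  note cu = Q.orbit_graph_continuous[OF u] and cw = P.orbit_graph_continuous[OF w]
  \<comment> \<open>The loop for \<open>chaotic_setI\<close> runs along both graphs over
    \<open>{a..b'}\<close>. Here \<open>b'\<close> is the midpoint if the graphs coincide, and
    \<open>b\<close> otherwise.\<close>
  have main: "chaotic_set X (\<lambda>x. {f x, g x}) (between u w a b)"
    if ab: "x1 \<le> a" "a < b" "b \<le> x2" "u a = w a" "u b = w b"
      and sgn: "\<forall>x\<in>{a..b}. 0 \<le> \<epsilon> * (u x - w x)" "\<epsilon> \<in> {1, - 1 :: real}"
      and b': "a < b'" "b' \<le> b" "u b' = w b'"
      and proper: "graph u a b' \<union> graph w a b' \<noteq> between u w a b"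
    for a b b' \<epsilon>
  proof (rule chaotic_setI[OF cont])
    let ?V = "between u w a b" and ?W = "graph u a b' \<union> graph w a b'"
    show "?V \<subseteq> X"
    proof
      fix z assume z: "z \<in> ?V"
      have "Q.H (Q.cx z) (Q.cy z) \<in> ?V" using z by simp
      then have "Q.cx z \<in> {a..b}" "0 \<le> \<epsilon> * (Q.cy z - w (Q.cx z))" "0 \<le> \<epsilon> * (u (Q.cx z) - Q.cy z)"
        unfolding in_between_iff[OF sgn] by auto
      then have "Q.cx z \<in> {x0..x3}" "\<bar>Q.cy z\<bar> \<le> 1"
        using bound[of "Q.cx z"] sgn(2) ab xs_order by (auto simp: abs_le_iff)
      \<comment> \<open>Membership in \<open>X\<close> is read off from a solution in
        \<open>X\<close> that starts at \<open>z\<close>.\<close>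
      then obtain \<sigma> where "\<sigma> 0 = z" "ode_solution hQ X {- E..E} \<sigma>" using Q.solvable by blast
      then show "z \<in> X" using Q.strip_bounds by (force simp: ode_solution_def)
    qed
    show "compact ?V"
      using ab by (intro compact_between continuous_on_subset[OF cu] continuous_on_subset[OF cw]) auto
    show "(arc_of {f, g} ?V)\<^sup>+\<^sup>+ p q" if "p \<in> ?V" "q \<in> ?V" "p \<noteq> q" for p q
      using rtranclpD[OF between_strongly_connected[OF Fs u w _ _ _ ab(4,5) sgn _ that(1,2)]] that ab bound
      by auto
    show "closed ?W"
      using ab b' by (intro closed_Un compact_imp_closed compact_graph continuous_on_subset[OF cu]
          continuous_on_subset[OF cw]) auto
    have "graph v a b' \<subseteq> graph v a b" for v using b' by (auto simp: graph_def)
    then have sub: "?W \<subseteq> ?V" using graph_subset_between[where a = a and b = b] by blast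
    then show "?W \<subset> ?V" using proper by blast
    show "(arc_of {f, g} ?W)\<^sup>+\<^sup>+ (Q.H a (u a)) (Q.H b' (u b'))" "(arc_of {f, g} ?W)\<^sup>+\<^sup>+ (Q.H b' (u b')) (Q.H a (u a))"
      using closed_orbit_polygon[OF Fs u w ab(1) b'(1) _ ab(4) b'(3)] b' ab by auto
    show "Q.H a (u a) \<noteq> Q.H b' (u b')" using b' by simp
    show "Q.H a (u a) \<in> ?V" "Q.H b' (u b') \<in> ?V"
      using sub b' by (auto simp: graph_def)
  qed
  show ?thesis
  proof (cases "\<forall>x\<in>{x1..x2}. u x = w x")
    case True
    \<comment> \<open>The region is a single arc; an oscillation over its left half misses the end
      over \<open>x2\<close>.\<close>
    let ?m = "(x1 + x2) / 2"
    have "Q.H x2 (u x2) \<in> between u w x1 x2"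
      using graph_subset_between(1)[of u x1 x2 w] xs_order by (auto simp: graph_def)
    moreover have "Q.H x2 (u x2) \<notin> graph u x1 ?m \<union> graph w x1 ?m"
      using xs_order by (auto simp: graph_def)
    ultimately have "graph u x1 ?m \<union> graph w x1 ?m \<noteq> between u w x1 x2" by blast
    then have "chaotic_set X (\<lambda>x. {f x, g x}) (between u w x1 x2)"
      using True xs_order ends by (intro main[of x1 x2 1 ?m]) auto
    then show ?thesis by blast
  next
    case False
    then obtain x where x: "x \<in> {x1..x2}" "u x \<noteq> w x" by blast
    define \<epsilon> where "\<epsilon> = sgn (u x - w x)"
    have \<epsilon>: "\<epsilon> \<in> {1, - 1}" "0 < \<epsilon> * (u x - w x)" using x by (auto simp: \<epsilon>_def sgn_if)
    let ?d = "\<lambda>t. \<epsilon> * (u t - w t)"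
    have cd: "continuous_on {s..t} ?d" if "x1 \<le> s" "t \<le> x2" for s t
      using that by (intro continuous_intros continuous_on_subset[OF cu] continuous_on_subset[OF cw]) auto
    obtain a where a: "a \<in> {x1..x}" "?d a = 0" "\<And>t. t \<in> {a..x} \<Longrightarrow> 0 \<le> ?d t"
      using last_zero[OF cd[of x1 x]] x \<epsilon> ends by auto
    obtain b where b: "b \<in> {x..x2}" "?d b = 0" "\<And>t. t \<in> {x..b} \<Longrightarrow> 0 \<le> ?d t"
      using first_zero[OF cd[of x x2]] x \<epsilon> ends by auto
    have eq: "u a = w a" "u b = w b" using a(2) b(2) \<epsilon> by auto
    have lt: "a < x" "x < b" using a b eq x by (auto simp: less_le)
    have "0 \<le> ?d t" if "t \<in> {a..b}" for t using a(3)[of t] b(3)[of t] that by (cases "t \<le> x") auto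
    then have sgn: "\<forall>t\<in>{a..b}. 0 \<le> ?d t" by blast
    \<comment> \<open>An interior point of the region, which the boundary loop misses.\<close>
    let ?y = "(u x + w x) / 2"
    have "Q.H x ?y \<in> between u w a b"
      unfolding in_between_iff[OF sgn \<epsilon>(1)] using \<epsilon> lt by auto
    moreover have "Q.H x ?y \<notin> graph u a b \<union> graph w a b"
      using x(2) by (auto simp: graph_def)
    ultimately have "graph u a b \<union> graph w a b \<noteq> between u w a b" by blast
    then have "chaotic_set X (\<lambda>x. {f x, g x}) (between u w a b)"
      using lt a b eq by (intro main[OF _ _ _ _ _ sgn \<epsilon>(1)]) auto
    then show ?thesis by blast
  qed
qed

end

section \<open>The fields near a saddle\<close>

lemma generates_flow_unique: "generates_flow f X \<Longrightarrow> unique_solutions f X"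
  unfolding unique_solutions_def
proof (intro allI impI ballI)
  fix I1 I2 \<sigma>1 \<sigma>2 and t :: real
  assume flow: "generates_flow f X"
    and *: "ode_solution f X I1 \<sigma>1 \<and> ode_solution f X I2 \<sigma>2 \<and> 0 \<in> I1 \<inter> I2 \<and> \<sigma>1 0 = \<sigma>2 0"
    and t: "t \<in> I1 \<inter> I2"
  have "\<sigma>1 0 \<in> X" using * by (auto simp: ode_solution_def)
  moreover obtain J \<phi> where J: "\<forall>x\<in>X. 0 \<in> J x \<and> \<phi> 0 x = x \<and> ode_solution f X (J x) (\<lambda>t. \<phi> t x) \<and>
      (\<forall>I \<gamma>. ode_solution f X I \<gamma> \<and> 0 \<in> I \<and> \<gamma> 0 = x \<longrightarrow> I \<subseteq> J x \<and> (\<forall>t\<in>I. \<gamma> t = \<phi> t x))"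
    using flow unfolding generates_flow_def by (elim exE conjE) (rule that)
  ultimately have uniq: "\<forall>I \<gamma>. ode_solution f X I \<gamma> \<and> 0 \<in> I \<and> \<gamma> 0 = \<sigma>1 0 \<longrightarrow> I \<subseteq> J (\<sigma>1 0) \<and> (\<forall>t\<in>I. \<gamma> t = \<phi> t (\<sigma>1 0))"
    by blast
  have "\<sigma>1 t = \<phi> t (\<sigma>1 0)" "\<sigma>2 t = \<phi> t (\<sigma>1 0)"
    using uniq[THEN spec[of _ I1], THEN spec[of _ \<sigma>1]] uniq[THEN spec[of _ I2], THEN spec[of _ \<sigma>2]] * t
    by (metis IntD1, metis IntD2)
  then show "\<sigma>1 t = \<sigma>2 t" by simp
qed

text \<open>The domain of the flow is open and contains \<open>(0, x)\<close>, hence a product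
  neighbourhood; this gives one existence time for all nearby starting points.\<close>

lemma generates_flow_solvable:
  assumes flow: "generates_flow f X" and x: "x \<in> X"
  obtains E \<rho> where "0 < E" "0 < \<rho>"
    "\<And>z. norm (z - x) < \<rho> \<Longrightarrow> \<exists>\<sigma>. \<sigma> 0 = z \<and> ode_solution f X {-E..E} \<sigma>"
proof -
  obtain J \<phi> where J': "\<forall>x\<in>X. 0 \<in> J x \<and> \<phi> 0 x = x \<and> ode_solution f X (J x) (\<lambda>t. \<phi> t x) \<and>
      (\<forall>I \<gamma>. ode_solution f X I \<gamma> \<and> 0 \<in> I \<and> \<gamma> 0 = x \<longrightarrow> I \<subseteq> J x \<and> (\<forall>t\<in>I. \<gamma> t = \<phi> t x))"
    and op: "open {(t, x). x \<in> X \<and> t \<in> J x}"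
    using flow unfolding generates_flow_def by (elim exE conjE) (rule that)
  have J: "0 \<in> J x \<and> \<phi> 0 x = x \<and> ode_solution f X (J x) (\<lambda>t. \<phi> t x)" if "x \<in> X" for x
    using J' that by blast
  have "(0, x) \<in> {(t, x). x \<in> X \<and> t \<in> J x}" using J x by auto
  then obtain A B where AB: "open A" "open B" "(0, x) \<in> A \<times> B" "A \<times> B \<subseteq> {(t, x). x \<in> X \<and> t \<in> J x}"
    using open_prod_elim[OF op] by blast
  obtain E where E: "0 < E" "cball 0 E \<subseteq> A" using AB open_contains_cball[of A] by auto
  obtain \<rho> where \<rho>: "0 < \<rho>" "ball x \<rho> \<subseteq> B" using AB open_contains_ball[of B] by auto
  show ?thesis
  proof (rule that[OF E(1) \<rho>(1)])
    fix z assume "norm (z - x) < \<rho>"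
    then have z: "z \<in> B" using \<rho> by (auto simp: dist_norm norm_minus_commute)
    have "0 \<in> A" using E by auto
    then have zX: "z \<in> X" using AB z by auto
    have "{-E..E} \<subseteq> J z" using E(2) AB(4) z by (auto simp: subset_eq dist_real_def abs_le_iff)
    then have "ode_solution f X {-E..E} (\<lambda>t. \<phi> t z)"
      using J[OF zX] by (intro ode_solution_subinterval[of f X "J z"]) (auto simp: ode_solution_def)
    then show "\<exists>\<sigma>. \<sigma> 0 = z \<and> ode_solution f X {-E..E} \<sigma>"
      using J[OF zX] by (intro exI[of _ "\<lambda>t. \<phi> t z"]) simp
  qed
qed

lemma signed_solvable:
  fixes \<theta> :: real
  assumes "\<theta> \<in> {1, -1}" and "\<exists>\<sigma>. \<sigma> 0 = z \<and> ode_solution h X {-E..E} \<sigma>"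
  shows "\<exists>\<sigma>. \<sigma> 0 = z \<and> ode_solution (\<lambda>x. \<theta> *\<^sub>R h x) X {-E..E} \<sigma>"
proof -
  obtain \<sigma> where \<sigma>: "\<sigma> 0 = z" "ode_solution h X {-E..E} \<sigma>" using assms by blast
  from ode_solution_reverse[OF this(2)] have "ode_solution (\<lambda>x. - h x) X {-E..E} (\<lambda>t. \<sigma> (- t))" by simp
  moreover have "\<sigma> (- 0) = z" using \<sigma> by simp
  ultimately have "\<exists>\<sigma>. \<sigma> 0 = z \<and> ode_solution (\<lambda>x. - h x) X {-E..E} \<sigma>"
    by (intro exI[of _ "\<lambda>t. \<sigma> (- t)"]) simp
  then show ?thesis using assms by auto
qed

lemma signed_unique:
  fixes \<theta> :: real
  shows "\<theta> \<in> {1, -1} \<Longrightarrow> unique_solutions h X \<Longrightarrow> unique_solutions (\<lambda>x. \<theta> *\<^sub>R h x) X"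
  using unique_solutions_reverse[of h X] by auto

section \<open>Charts along the eigenvectors\<close>

text \<open>Lengths are measured in units of \<open>r\<close>: a box of fixed size in the new
  coordinates shrinks to the origin of the chart as \<open>r\<close> tends to 0.\<close>

lemma chart_scale:
  assumes "chart e e' Lx Ly" and "r \<noteq> 0"
  shows "chart (r *\<^sub>R e) (r *\<^sub>R e') (\<lambda>z. Lx z / r) (\<lambda>z. Ly z / r)"
proof -
  interpret chart xs e e' Lx Ly by fact
  show ?thesis
  proof (rule chart.intro)
    show "bounded_linear (\<lambda>z. Lx z / r)" "bounded_linear (\<lambda>z. Ly z / r)"
      using Lx Ly by (auto intro: bounded_linear_compose[OF bounded_linear_divide])
    show "z = (Lx z / r) *\<^sub>R r *\<^sub>R e + (Ly z / r) *\<^sub>R r *\<^sub>R e'" for z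
      using expansion[of z] assms(2) by simp
  qed (use dual assms(2) linear_scale[OF bounded_linear.linear[OF Lx]]
      linear_scale[OF bounded_linear.linear[OF Ly]] in auto)
qed

text \<open>Cramer's rule, with the determinant \<open>\<Delta>\<close>.\<close>

lemma plane_chart:
  fixes e e' :: "real^2"
  assumes "e $ 1 * e' $ 2 \<noteq> e $ 2 * e' $ 1"
  obtains Lx Ly where "chart e e' Lx Ly"
proof -
  define \<Delta> where "\<Delta> = e $ 1 * e' $ 2 - e $ 2 * e' $ 1"
  have \<Delta>: "\<Delta> \<noteq> 0" using assms by (simp add: \<Delta>_def)
  have "chart e e' (\<lambda>z. (z $ 1 * e' $ 2 - z $ 2 * e' $ 1) / \<Delta>) (\<lambda>z. (e $ 1 * z $ 2 - e $ 2 * z $ 1) / \<Delta>)"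
  proof (rule chart.intro)
    show "bounded_linear (\<lambda>z::real^2. (z $ 1 * e' $ 2 - z $ 2 * e' $ 1) / \<Delta>)"
      "bounded_linear (\<lambda>z::real^2. (e $ 1 * z $ 2 - e $ 2 * z $ 1) / \<Delta>)"
      by (intro bounded_linear_compose[OF bounded_linear_divide] bounded_linear_sub
          bounded_linear_compose[OF bounded_linear_mult_left] bounded_linear_compose[OF bounded_linear_mult_right]
          bounded_linear_vec_nth)+
    show "z = ((z $ 1 * e' $ 2 - z $ 2 * e' $ 1) / \<Delta>) *\<^sub>R e + ((e $ 1 * z $ 2 - e $ 2 * z $ 1) / \<Delta>) *\<^sub>R e'" for z
    proof -
      have "\<Delta> * z $ 1 = (z $ 1 * e' $ 2 - z $ 2 * e' $ 1) * e $ 1 + (e $ 1 * z $ 2 - e $ 2 * z $ 1) * e' $ 1"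
        "\<Delta> * z $ 2 = (z $ 1 * e' $ 2 - z $ 2 * e' $ 1) * e $ 2 + (e $ 1 * z $ 2 - e $ 2 * z $ 1) * e' $ 2"
        by (simp_all add: \<Delta>_def algebra_simps)
      then show ?thesis
        using \<Delta> by (simp add: vec_eq_iff forall_2 eq_divide_eq mult.commute flip: add_divide_distrib)
    qed
  qed (use \<Delta> in \<open>simp_all add: \<Delta>_def mult.commute\<close>)
  then show ?thesis by (rule that)
qed

text \<open>A vanishing determinant gives \<open>e' $ i *\<^sub>R e = e $ i *\<^sub>R e'\<close>.
  Applying \<open>A\<close> multiplies the two sides by the different numbers \<open>l\<close> and
  \<open>m\<close>, so \<open>e'\<close> would be 0.\<close>

lemma eigenvectors_independent:
  fixes A :: "real^2^2"
  assumes "eigenpair A l e" "eigenpair A m e'" and "l \<noteq> m"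
  shows "e $ 1 * e' $ 2 \<noteq> e $ 2 * e' $ 1"
proof
  assume det: "e $ 1 * e' $ 2 = e $ 2 * e' $ 1"
  have "e' $ i *\<^sub>R e = e $ i *\<^sub>R e'" for i
    using det exhaust_2[of i] by (auto simp: vec_eq_iff forall_2 mult.commute)
  then have "A *v (e' $ i *\<^sub>R e) = A *v (e $ i *\<^sub>R e')" for i by metis
  then have "(e' $ i * l) *\<^sub>R e = (m * e $ i) *\<^sub>R e'" for i
    using assms by (simp add: eigenpair_def matrix_vector_mult_scaleR mult.commute)
  moreover have "(m * e $ i) *\<^sub>R e' = (m * e' $ i) *\<^sub>R e" for i
    using \<open>\<And>i. e' $ i *\<^sub>R e = e $ i *\<^sub>R e'\<close>[of i] by (metis scaleR_scaleR)
  ultimately have "(e' $ i * l) *\<^sub>R e = (m * e' $ i) *\<^sub>R e" for i by metis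
  then have "e' $ i * l = m * e' $ i" for i
    using assms(1) by (metis eigenpair_def scaleR_cancel_right)
  then have "e' = 0" using assms(3) by (simp add: vec_eq_iff mult.commute[of m])
  then show False using assms(2) by (simp add: eigenpair_def)
qed

text \<open>Here \<open>(p, q)\<close> is the rescaled \<open>f\<close> at \<open>(x, y)\<close>,
  close to \<open>(- \<theta> * a * x, \<theta> * b * y)\<close>. After multiplication by
  \<open>- \<theta>\<close> the first component lies between \<open>a / 4\<close> and
  \<open>3 * a\<close>, and the second is \<open>- b * y\<close> up to \<open>b / 16\<close>. At
  distance 1/8 from the axis at least \<open>b / 16 = b / (48 * a) * (3 * a)\<close>
  remains.\<close>

lemma saddle_slopes:
  fixes a b p q x y \<theta> :: real
  assumes \<theta>: "\<theta> \<in> {1, - 1}" and ab: "0 < a" "0 < b" and xy: "1/2 \<le> x" "x \<le> 2" "\<bar>y\<bar> \<le> 1"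
    and p: "\<bar>p + \<theta> * a * x\<bar> \<le> a / 4" and q: "\<bar>q - \<theta> * b * y\<bar> \<le> b / 16"
  shows "a / 4 \<le> - \<theta> * p" and "\<bar>- \<theta> * q\<bar> \<le> 8 * b / a * (- \<theta> * p)"
    and "1/8 \<le> y \<Longrightarrow> - \<theta> * q \<le> - (b / (48 * a)) * (- \<theta> * p)"
    and "y \<le> - 1/8 \<Longrightarrow> b / (48 * a) * (- \<theta> * p) \<le> - \<theta> * q"
proof -
  define P Q where "P = - \<theta> * p" and "Q = - \<theta> * q"
  have "a * (1/2) \<le> a * x" "a * x \<le> a * 2" using ab xy by (auto intro: mult_left_mono)
  moreover have "\<bar>P - a * x\<bar> \<le> a / 4" using p \<theta> unfolding P_def abs_le_iff by auto
  ultimately have P: "a / 4 \<le> P" "P \<le> 3 * a" using ab by linarith+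
  have Q: "\<bar>Q + b * y\<bar> \<le> b / 16" using q \<theta> unfolding Q_def abs_le_iff by auto
  have "\<bar>b * y\<bar> \<le> b" using xy ab by (simp add: abs_mult)
  then have "\<bar>Q\<bar> \<le> 2 * b" using Q ab by linarith
  moreover have "8 * b / a * (a / 4) \<le> 8 * b / a * P" using P ab by (intro mult_left_mono) auto
  ultimately have Q2: "\<bar>Q\<bar> \<le> 8 * b / a * P" using ab by simp
  have "b / (48 * a) * P \<le> b / (48 * a) * (3 * a)" using P ab by (intro mult_left_mono) auto
  then have s: "b / (48 * a) * P \<le> b / 16" using ab by simp
  show "a / 4 \<le> - \<theta> * p" using P by (simp add: P_def)
  show "\<bar>- \<theta> * q\<bar> \<le> 8 * b / a * (- \<theta> * p)" using Q2 by (simp add: P_def Q_def)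
  show "- \<theta> * q \<le> - (b / (48 * a)) * (- \<theta> * p)" if y: "1/8 \<le> y"
  proof -
    have "b * (1/8) \<le> b * y" using ab y by (intro mult_left_mono) auto
    then have "Q \<le> - (b / (48 * a) * P)" using Q s by linarith
    then show ?thesis by (simp add: P_def Q_def)
  qed
  show "b / (48 * a) * (- \<theta> * p) \<le> - \<theta> * q" if y: "y \<le> - 1/8"
  proof -
    have "b * y \<le> b * (- 1/8)" using ab y by (intro mult_left_mono) auto
    then have "b / (48 * a) * P \<le> Q" using Q s by linarith
    then show ?thesis by (simp add: P_def Q_def)
  qed
qed

section \<open>Estimates in small boxes around the saddle\<close>

context chart
begin

lemma coordinate_bound:
  obtains K where "0 < K" "\<And>z. \<bar>Lx z\<bar> \<le> K * norm z" "\<And>z. \<bar>Ly z\<bar> \<le> K * norm z"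
proof -
  obtain K1 where K1: "0 < K1" "\<And>z. norm (Lx z) \<le> norm z * K1" using bounded_linear.pos_bounded[OF Lx] by blast
  obtain K2 where K2: "0 < K2" "\<And>z. norm (Ly z) \<le> norm z * K2" using bounded_linear.pos_bounded[OF Ly] by blast
  show ?thesis
  proof (rule that[of "K1 + K2"])
    show "\<bar>Lx z\<bar> \<le> (K1 + K2) * norm z" for z
      using K1(2)[of z] K2(1) by (simp add: algebra_simps add_increasing2)
    show "\<bar>Ly z\<bar> \<le> (K1 + K2) * norm z" for z
      using K2(2)[of z] K1(1) by (simp add: algebra_simps add_increasing)
  qed (use K1 K2 in auto)
qed

text \<open>Twice as wide as high, because the rescaled strip reaches up to first coordinate 2 and
  height 1.\<close>

definition in_box :: "real \<Rightarrow> 'a \<Rightarrow> bool" where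
  "in_box r z \<longleftrightarrow> \<bar>Lx (z - xs)\<bar> \<le> 2 * r \<and> \<bar>Ly (z - xs)\<bar> \<le> r"

lemma in_box_norm:
  obtains C where "0 < C" "\<And>r z. in_box r z \<Longrightarrow> norm (z - xs) \<le> C * r"
proof (rule that)
  show "0 < 2 * norm e + norm e' + 1" by (simp add: add_nonneg_pos)
  fix r z assume z: "in_box r z"
  then have "0 \<le> r" unfolding in_box_def by linarith
  have "norm (z - xs) \<le> \<bar>Lx (z - xs)\<bar> * norm e + \<bar>Ly (z - xs)\<bar> * norm e'"
    by (subst expansion[of "z - xs"]) (metis norm_scaleR norm_triangle_ineq)
  also have "\<dots> \<le> 2 * r * norm e + r * norm e'"
    using z by (intro add_mono mult_right_mono) (auto simp: in_box_def)
  also have "\<dots> \<le> (2 * norm e + norm e' + 1) * r" using \<open>0 \<le> r\<close> by (simp add: algebra_simps)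
  finally show "norm (z - xs) \<le> (2 * norm e + norm e' + 1) * r" .
qed

lemma in_box_small:
  assumes "0 < \<rho>"
  obtains d where "0 < d" "\<And>r z. r < d \<Longrightarrow> in_box r z \<Longrightarrow> norm (z - xs) < \<rho>"
proof -
  obtain C where C: "0 < C" "\<And>r z. in_box r z \<Longrightarrow> norm (z - xs) \<le> C * r" by (rule in_box_norm) blast
  show ?thesis
  proof (rule that[of "\<rho> / C"])
    show "norm (z - xs) < \<rho>" if "r < \<rho> / C" "in_box r z" for r z
      using C(2)[OF that(2)] that(1) C(1) by (simp add: field_simps)
  qed (use C assms in auto)
qed

text \<open>The linearization error is small compared with the distance to \<open>xs\<close>, which
  is at most a constant times \<open>r\<close> in the box. After division by \<open>r\<close> the
  error is uniformly small.\<close>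

lemma linearization_estimate:
  assumes f: "(f has_derivative F) (at xs)" "f xs = 0"
    and F: "F e = l *\<^sub>R e" "F e' = m *\<^sub>R e'" and "0 < \<epsilon>"
  obtains d where "0 < d" "\<And>r z. 0 < r \<Longrightarrow> r < d \<Longrightarrow> in_box r z \<Longrightarrow>
      \<bar>Lx (f z) / r - l * (Lx (z - xs) / r)\<bar> \<le> \<epsilon> \<and> \<bar>Ly (f z) / r - m * (Ly (z - xs) / r)\<bar> \<le> \<epsilon>"
proof -
  obtain C where C: "0 < C" "\<And>r z. in_box r z \<Longrightarrow> norm (z - xs) \<le> C * r" by (rule in_box_norm) blast
  obtain K where K: "0 < K" "\<And>z. \<bar>Lx z\<bar> \<le> K * norm z" "\<And>z. \<bar>Ly z\<bar> \<le> K * norm z"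
    by (rule coordinate_bound) blast
  \<comment> \<open>\<open>C\<close> passes from \<open>r\<close> to the distance and
    \<open>K\<close> from the norm to the coordinates.\<close>
  define \<epsilon>' where "\<epsilon>' = \<epsilon> / (K * C)"
  have "0 < \<epsilon>'" using assms(5) C K by (simp add: \<epsilon>'_def)
  then obtain \<rho> where \<rho>: "0 < \<rho>" "\<And>z. norm (z - xs) < \<rho> \<Longrightarrow> norm (f z - F (z - xs)) \<le> \<epsilon>' * norm (z - xs)"
    using f unfolding has_derivative_at_alt by (metis diff_zero)
  obtain d where d: "0 < d" "\<And>r z. r < d \<Longrightarrow> in_box r z \<Longrightarrow> norm (z - xs) < \<rho>"
    using in_box_small[OF \<rho>(1)] by blast
  interpret F: bounded_linear F using f(1) by (rule has_derivative_bounded_linear)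
  interpret Lx: bounded_linear Lx by (rule Lx)
  interpret Ly: bounded_linear Ly by (rule Ly)
  have LF: "Lx (F z) = l * Lx z" "Ly (F z) = m * Ly z" for z
  proof -
    have "F z = (l * Lx z) *\<^sub>R e + (m * Ly z) *\<^sub>R e'"
      by (subst expansion[of z]) (simp add: F.add F.scaleR F mult.commute)
    then show "Lx (F z) = l * Lx z" "Ly (F z) = m * Ly z"
      by (simp_all add: Lx.add Lx.scaleR Ly.add Ly.scaleR dual)
  qed
  show ?thesis
  proof (rule that[OF d(1)])
    fix r z assume r: "0 < r" "r < d" and z: "in_box r z"
    have "norm (f z - F (z - xs)) \<le> \<epsilon>' * norm (z - xs)" by (rule \<rho>(2)[OF d(2)[OF r(2) z]])
    also have "\<dots> \<le> \<epsilon>' * (C * r)" using C(2)[OF z] \<open>0 < \<epsilon>'\<close> by simp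
    finally have "K * norm (f z - F (z - xs)) \<le> K * (\<epsilon>' * (C * r))" using K(1) by simp
    also have "\<dots> = \<epsilon> * r" using K C by (simp add: \<epsilon>'_def)
    finally have *: "K * norm (f z - F (z - xs)) \<le> \<epsilon> * r" .
    have "\<bar>Lx (f z) - l * Lx (z - xs)\<bar> \<le> \<epsilon> * r" "\<bar>Ly (f z) - m * Ly (z - xs)\<bar> \<le> \<epsilon> * r"
      using K(2)[of "f z - F (z - xs)"] K(3)[of "f z - F (z - xs)"] * by (simp_all add: Lx.diff Ly.diff LF)
    moreover have "\<bar>Lx (f z) / r - l * (Lx (z - xs) / r)\<bar> = \<bar>Lx (f z) - l * Lx (z - xs)\<bar> / r"
      "\<bar>Ly (f z) / r - m * (Ly (z - xs) / r)\<bar> = \<bar>Ly (f z) - m * Ly (z - xs)\<bar> / r"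
      using r by (simp_all add: diff_divide_distrib[symmetric])
    ultimately show "\<bar>Lx (f z) / r - l * (Lx (z - xs) / r)\<bar> \<le> \<epsilon> \<and> \<bar>Ly (f z) / r - m * (Ly (z - xs) / r)\<bar> \<le> \<epsilon>"
      using r by (simp add: divide_le_eq)
  qed
qed

lemma continuity_estimate:
  assumes g: "isCont g xs" and "0 < \<epsilon>"
  obtains d where "0 < d" "\<And>r z. r < d \<Longrightarrow> in_box r z \<Longrightarrow>
      \<bar>Lx (g z) - Lx (g xs)\<bar> \<le> \<epsilon> \<and> \<bar>Ly (g z) - Ly (g xs)\<bar> \<le> \<epsilon>"
proof -
  obtain K where K: "0 < K" "\<And>z. \<bar>Lx z\<bar> \<le> K * norm z" "\<And>z. \<bar>Ly z\<bar> \<le> K * norm z"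
    by (rule coordinate_bound) blast
  interpret Lx: bounded_linear Lx by (rule Lx)
  interpret Ly: bounded_linear Ly by (rule Ly)
  obtain \<rho> where \<rho>: "0 < \<rho>" "\<And>z. norm (z - xs) < \<rho> \<Longrightarrow> norm (g z - g xs) < \<epsilon> / K"
    using g assms(2) K(1) unfolding continuous_at_eps_delta dist_norm by (metis divide_pos_pos)
  obtain d where d: "0 < d" "\<And>r z. r < d \<Longrightarrow> in_box r z \<Longrightarrow> norm (z - xs) < \<rho>"
    using in_box_small[OF \<rho>(1)] by blast
  show ?thesis
  proof (rule that[OF d(1)])
    fix r z assume "r < d" "in_box r z"
    then have "norm (g z - g xs) < \<epsilon> / K" using \<rho> d by blast
    then have "K * norm (g z - g xs) \<le> \<epsilon>" using K(1) by (simp add: field_simps)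
    then show "\<bar>Lx (g z) - Lx (g xs)\<bar> \<le> \<epsilon> \<and> \<bar>Ly (g z) - Ly (g xs)\<bar> \<le> \<epsilon>"
      using K(2)[of "g z - g xs"] K(3)[of "g z - g xs"] by (simp add: Lx.diff Ly.diff)
  qed
qed

end

section \<open>Choice of constants and conclusion\<close>

text \<open>The eigenvalue \<open>l\<close> along \<open>g xs\<close> may have either sign, so that
  the stable and the unstable direction are treated together; the sign is carried by
  \<open>\<theta>\<close>.\<close>

lemma saddle_chaotic_set:
  fixes f g :: "real^2 \<Rightarrow> real^2"
  assumes "open X" and cont: "continuous_on X f" "continuous_on X g"
    and flows: "generates_flow f X" "generates_flow g X"
    and xs: "xs \<in> X" "f xs = 0" "g xs \<noteq> 0"
    and deriv: "(f has_derivative (\<lambda>v. A *v v)) (at xs)"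
    and eig: "eigenpair A l e" "eigenpair A m e'" "l * m < 0" and g: "g xs = \<alpha> *\<^sub>R e"
  shows "\<exists>V. chaotic_set X (\<lambda>x. {f x, g x}) V"
proof -
  define \<theta> a b where "\<theta> = - sgn l" and "a = \<bar>l\<bar>" and "b = \<bar>m\<bar>"
  have ab: "0 < a" "0 < b" using eig(3) by (auto simp: a_def b_def)
  have \<theta>: "\<theta> \<in> {1, - 1}" using eig(3) by (auto simp: \<theta>_def sgn_if)
  have lm: "l = - \<theta> * a" "m = \<theta> * b"
    using eig(3) by (auto simp: \<theta>_def a_def b_def sgn_if mult_less_0_iff)
  \<comment> \<open>With this axis \<open>g xs\<close> is \<open>\<theta> *\<^sub>R e0\<close>,
    while the linear part of \<open>f\<close> along \<open>e0\<close> is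
    \<open>- \<theta> * a * x\<close>. Where \<open>x\<close> is positive,
    \<open>\<theta> *\<^sub>R g\<close> and \<open>- \<theta> *\<^sub>R f\<close> therefore both
    point to the right.\<close>
  define e0 where "e0 = \<theta> *\<^sub>R g xs"
  have g0: "g xs = \<theta> *\<^sub>R e0" using \<theta> by (auto simp: e0_def)
  have e0: "eigenpair A l e0"
    using eig(1) xs(3) \<theta> g by (auto simp: eigenpair_def e0_def matrix_vector_mult_scaleR scaleR_minus_left)
  have "l \<noteq> m" using eig(3) by (auto simp: mult_less_0_iff)
  from plane_chart[OF eigenvectors_independent[OF e0 eig(2) this]]
  obtain Lx Ly where chart: "chart e0 e' Lx Ly" by blast
  interpret K: chart xs e0 e' Lx Ly by fact
  interpret Lx: bounded_linear Lx by (rule K.Lx)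
  interpret Ly: bounded_linear Ly by (rule K.Ly)
  \<comment> \<open>\<open>c\<close> and \<open>M\<close> are the constants of
    \<open>saddle_slopes\<close>; \<open>k\<close> is half the slope \<open>b / (48 * a)\<close>
    that \<open>f\<close> attains away from the axis.\<close>
  define c k M where "c = a / 4" and "k = b / (96 * a)" and "M = 8 * b / a"
  have pos: "0 < c" "0 < k" "0 < M" using ab by (auto simp: c_def k_def M_def)
  obtain Ef \<rho>f where Ef: "0 < Ef" "0 < \<rho>f"
    "\<And>z. norm (z - xs) < \<rho>f \<Longrightarrow> \<exists>\<sigma>. \<sigma> 0 = z \<and> ode_solution f X {-Ef..Ef} \<sigma>"
    using generates_flow_solvable[OF flows(1) xs(1)] by blast
  obtain Eg \<rho>g where Eg: "0 < Eg" "0 < \<rho>g"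
    "\<And>z. norm (z - xs) < \<rho>g \<Longrightarrow> \<exists>\<sigma>. \<sigma> 0 = z \<and> ode_solution g X {-Eg..Eg} \<sigma>"
    using generates_flow_solvable[OF flows(2) xs(1)] by blast
  define E where "E = min Ef Eg"
  have E: "0 < E" using Ef Eg by (simp add: E_def)
  have shrink: "\<exists>\<sigma>. \<sigma> 0 = z \<and> ode_solution h X {-E..E} \<sigma>"
    if ex: "\<exists>\<sigma>. \<sigma> 0 = z \<and> ode_solution h X {-E'..E'} \<sigma>" and le: "E \<le> E'" for h E' z
  proof -
    obtain \<sigma> where \<sigma>: "\<sigma> 0 = z" "ode_solution h X {-E'..E'} \<sigma>" using ex by blast
    have "{-E..E} \<subseteq> {-E'..E'}" using le by auto
    moreover from this have "\<sigma> ` {-E..E} \<subseteq> X" using \<sigma>(2) unfolding ode_solution_def by blast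
    ultimately have "ode_solution h X {-E..E} \<sigma>" by (intro ode_solution_subinterval[OF \<sigma>(2)])
    with \<sigma>(1) show ?thesis by blast
  qed
  \<comment> \<open>The strip from \<open>1 - \<eta>\<close> to \<open>1 + 2 * \<eta>\<close> has
    width \<open>3 * \<eta>\<close>. The three bounds keep it in \<open>{1/2..2}\<close>, limit the
    variation of graphs to 1/8 and allow a crossing within time \<open>E\<close>. All are
    independent of \<open>r\<close>, since the linear part of \<open>f\<close> is invariant under
    rescaling.\<close>
  define \<eta> where "\<eta> = min (1/2) (min (1 / (24 * M)) (c * E / 4))"
  have \<eta>: "0 < \<eta>" "\<eta> \<le> 1/2" "\<eta> \<le> 1 / (24 * M)" "\<eta> \<le> c * E / 4"
    using pos E by (auto simp: \<eta>_def)
  have M\<eta>: "M * (3 * \<eta>) \<le> 1/8" using \<eta>(3) pos by (simp add: field_simps)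
  have "0 < c * E" using pos E by simp
  then have E\<eta>: "3 * \<eta> < c * E" using \<eta>(4) by linarith
  obtain d1 where d1: "0 < d1" "\<And>r z. 0 < r \<Longrightarrow> r < d1 \<Longrightarrow> K.in_box r z \<Longrightarrow>
      \<bar>Lx (f z) / r - l * (Lx (z - xs) / r)\<bar> \<le> min (a / 4) (b / 16) \<and>
      \<bar>Ly (f z) / r - m * (Ly (z - xs) / r)\<bar> \<le> min (a / 4) (b / 16)"
  proof (rule K.linearization_estimate[OF deriv xs(2)])
    show "A *v e0 = l *\<^sub>R e0" "A *v e' = m *\<^sub>R e'" using e0 eig by (auto simp: eigenpair_def)
    show "0 < min (a / 4) (b / 16)" using ab by simp
  qed blast
  have "isCont g xs" using cont(2) \<open>open X\<close> xs(1) by (simp add: continuous_on_eq_continuous_at)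
  then obtain d2 where d2: "0 < d2" "\<And>r z. r < d2 \<Longrightarrow> K.in_box r z \<Longrightarrow>
      \<bar>Lx (g z) - Lx (g xs)\<bar> \<le> min (1/2) (k/2) \<and> \<bar>Ly (g z) - Ly (g xs)\<bar> \<le> min (1/2) (k/2)"
    using K.continuity_estimate[of g "min (1/2) (k/2)"] pos by auto
  obtain d3 where d3: "0 < d3" "\<And>r z. r < d3 \<Longrightarrow> K.in_box r z \<Longrightarrow> norm (z - xs) < min \<rho>f \<rho>g"
    using K.in_box_small[of "min \<rho>f \<rho>g"] Ef Eg by auto
  \<comment> \<open>Beyond smallness for the estimates, \<open>r \<le> 2 / a\<close> ensures that
    \<open>g\<close>, of first component at least 1/2 up to sign, has rescaled speed at least
    \<open>a / 4 = c\<close>.\<close>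
  define r where "r = min (min (d1/2) (d2/2)) (min (d3/2) (2 / a))"
  have r: "0 < r" "r < d1" "r < d2" "r < d3" "r \<le> 2 / a"
    using d1(1) d2(1) d3(1) ab by (auto simp: r_def min_less_iff_disj min_le_iff_disj)
  let ?Lx = "\<lambda>z. Lx z / r" and ?Ly = "\<lambda>z. Ly z / r"
  let ?hg = "\<lambda>z. \<theta> *\<^sub>R g z" and ?hf = "\<lambda>z. (- \<theta>) *\<^sub>R f z"
  have chart': "chart (r *\<^sub>R e0) (r *\<^sub>R e') ?Lx ?Ly" using r by (intro chart_scale[OF chart]) simp
  interpret S: chart xs "r *\<^sub>R e0" "r *\<^sub>R e'" ?Lx ?Ly by (rule chart')
  have box: "K.in_box r z" "1/2 \<le> S.cx z" "S.cx z \<le> 2" if "S.cx z \<in> {1 - \<eta>..1 + 2 * \<eta>}" "\<bar>S.cy z\<bar> \<le> 1" for z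
  proof -
    show x: "1/2 \<le> S.cx z" "S.cx z \<le> 2" using that \<eta> by auto
    have "\<bar>S.cx z\<bar> \<le> 2" using x by simp
    then show "K.in_box r z"
      using that(2) r(1) unfolding K.in_box_def S.cx_def S.cy_def by (simp add: divide_le_eq)
  qed
  have f_slopes: "c \<le> ?Lx (?hf z)" "\<bar>?Ly (?hf z)\<bar> \<le> M * ?Lx (?hf z)"
      "1/8 \<le> S.cy z \<Longrightarrow> ?Ly (?hf z) \<le> - (2 * k) * ?Lx (?hf z)"
      "S.cy z \<le> - 1/8 \<Longrightarrow> 2 * k * ?Lx (?hf z) \<le> ?Ly (?hf z)"
    if z: "S.cx z \<in> {1 - \<eta>..1 + 2 * \<eta>}" "\<bar>S.cy z\<bar> \<le> 1" for z
  proof -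
    have "\<bar>Lx (f z) / r + \<theta> * a * S.cx z\<bar> \<le> a / 4" "\<bar>Ly (f z) / r - \<theta> * b * S.cy z\<bar> \<le> b / 16"
      using d1(2)[OF r(1,2) box(1)[OF z]] by (auto simp: lm S.cx_def S.cy_def)
    note sl = saddle_slopes[OF \<theta> ab box(2,3)[OF z] z(2) this]
    have hf: "?Lx (?hf z) = - \<theta> * (Lx (f z) / r)" "?Ly (?hf z) = - \<theta> * (Ly (f z) / r)"
      by (simp_all only: Lx.scaleR Ly.scaleR real_scaleR_def times_divide_eq_right)
    have k2: "2 * k = b / (48 * a)" by (simp add: k_def)
    show "c \<le> ?Lx (?hf z)" "\<bar>?Ly (?hf z)\<bar> \<le> M * ?Lx (?hf z)"
      "1/8 \<le> S.cy z \<Longrightarrow> ?Ly (?hf z) \<le> - (2 * k) * ?Lx (?hf z)"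
      "S.cy z \<le> - 1/8 \<Longrightarrow> 2 * k * ?Lx (?hf z) \<le> ?Ly (?hf z)"
      unfolding hf k2 unfolding c_def M_def by (fact sl)+
  qed
  have g_slopes: "c \<le> ?Lx (?hg z)" "\<bar>?Ly (?hg z)\<bar> \<le> k * ?Lx (?hg z)" "\<bar>?Ly (?hg z)\<bar> \<le> M * ?Lx (?hg z)"
    if z: "S.cx z \<in> {1 - \<eta>..1 + 2 * \<eta>}" "\<bar>S.cy z\<bar> \<le> 1" for z
  proof -
    have "Lx (g xs) = \<theta>" "Ly (g xs) = 0" by (simp_all add: g0 Lx.scaleR Ly.scaleR K.dual)
    then have "\<bar>Lx (g z) - \<theta>\<bar> \<le> 1/2" "\<bar>Ly (g z)\<bar> \<le> k/2"
      using d2(2)[OF r(3) box(1)[OF z]] by auto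
    then have P: "1/2 \<le> \<theta> * Lx (g z)" and Q: "\<bar>\<theta> * Ly (g z)\<bar> \<le> k/2"
      using \<theta> unfolding abs_le_iff by auto
    have hg: "?Lx (?hg z) = \<theta> * Lx (g z) / r" "?Ly (?hg z) = \<theta> * Ly (g z) / r"
      by (simp_all add: Lx.scaleR Ly.scaleR)
    have "c * r \<le> 1/2" using r(5) ab by (simp add: c_def field_simps)
    then show c: "c \<le> ?Lx (?hg z)" using P r(1) unfolding hg by (simp add: le_divide_eq)
    have "k * (1/2) \<le> k * (\<theta> * Lx (g z))" using P pos by (intro mult_left_mono) auto
    then have "\<bar>\<theta> * Ly (g z)\<bar> / r \<le> k * (\<theta> * Lx (g z)) / r" using Q r(1) by (intro divide_right_mono) auto
    then show k: "\<bar>?Ly (?hg z)\<bar> \<le> k * ?Lx (?hg z)" unfolding hg using r(1) by simp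
    have "k \<le> M" using ab by (simp add: k_def M_def field_simps)
    then have "k * ?Lx (?hg z) \<le> M * ?Lx (?hg z)" using c pos by (intro mult_right_mono) linarith+
    then show "\<bar>?Ly (?hg z)\<bar> \<le> M * ?Lx (?hg z)" using k by linarith
  qed
  have fs: "strip_field xs (r *\<^sub>R e0) (r *\<^sub>R e') ?Lx ?Ly (1 - \<eta>) 1 (1 + \<eta>) (1 + 2 * \<eta>) c M E X ?hf"
  proof (intro strip_field.intro strip_field_axioms.intro chart')
    show "unique_solutions ?hf X"
      using signed_unique[of "- \<theta>" f X] \<theta> generates_flow_unique[OF flows(1)] by auto
    fix z assume z: "S.cx z \<in> {1 - \<eta>..1 + 2 * \<eta>}" "\<bar>S.cy z\<bar> \<le> 1"
    show "c \<le> ?Lx (?hf z) \<and> \<bar>?Ly (?hf z)\<bar> \<le> M * ?Lx (?hf z)" using f_slopes[OF z] by blast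
    have "norm (z - xs) < \<rho>f" using d3(2)[OF r(4) box(1)[OF z]] by simp
    then have "\<exists>\<sigma>. \<sigma> 0 = z \<and> ode_solution f X {- E..E} \<sigma>"
      by (intro shrink[OF Ef(3)]) (simp_all add: E_def)
    then show "\<exists>\<sigma>. \<sigma> 0 = z \<and> ode_solution ?hf X {- E..E} \<sigma>"
      using \<theta> by (intro signed_solvable) auto
  qed (use \<eta> pos E M\<eta> E\<eta> in auto)
  have gs: "strip_field xs (r *\<^sub>R e0) (r *\<^sub>R e') ?Lx ?Ly (1 - \<eta>) 1 (1 + \<eta>) (1 + 2 * \<eta>) c M E X ?hg"
  proof (intro strip_field.intro strip_field_axioms.intro chart')
    show "unique_solutions ?hg X"
      using signed_unique[OF \<theta>] generates_flow_unique[OF flows(2)] by blast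
    fix z assume z: "S.cx z \<in> {1 - \<eta>..1 + 2 * \<eta>}" "\<bar>S.cy z\<bar> \<le> 1"
    show "c \<le> ?Lx (?hg z) \<and> \<bar>?Ly (?hg z)\<bar> \<le> M * ?Lx (?hg z)" using g_slopes[OF z] by blast
    have "norm (z - xs) < \<rho>g" using d3(2)[OF r(4) box(1)[OF z]] by simp
    then have "\<exists>\<sigma>. \<sigma> 0 = z \<and> ode_solution g X {- E..E} \<sigma>"
      by (intro shrink[OF Eg(3)]) (simp_all add: E_def)
    then show "\<exists>\<sigma>. \<sigma> 0 = z \<and> ode_solution ?hg X {- E..E} \<sigma>"
      by (intro signed_solvable[OF \<theta>])
  qed (use \<eta> pos E M\<eta> E\<eta> in auto)
  interpret T: two_fields xs "r *\<^sub>R e0" "r *\<^sub>R e'" ?Lx ?Ly "1 - \<eta>" 1 "1 + \<eta>" "1 + 2 * \<eta>" c M E X ?hg ?hf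
    by (rule two_fields.intro[OF gs fs])
  interpret T': two_fields xs "r *\<^sub>R e0" "r *\<^sub>R e'" ?Lx ?Ly "1 - \<eta>" 1 "1 + \<eta>" "1 + 2 * \<eta>" c M E X ?hf ?hg
    by (rule two_fields.intro[OF fs gs])
  obtain u w where uw: "T.Q.orbit_graph u" "T.P.orbit_graph w" "u 1 = w 1" "u (1 + \<eta>) = w (1 + \<eta>)" "\<bar>u 1\<bar> \<le> 1/4"
  proof (rule T.common_end_points[of k "2 * k"])
    show "\<bar>?Ly (?hg z)\<bar> \<le> k * ?Lx (?hg z)" if "S.cx z \<in> {1 - \<eta>..1 + 2 * \<eta>}" "\<bar>S.cy z\<bar> \<le> 1" for z
      by (rule g_slopes(2)[OF that])
    show "?Ly (?hf z) \<le> - (2 * k) * ?Lx (?hf z)"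
      if "S.cx z \<in> {1 - \<eta>..1 + 2 * \<eta>}" "1/8 \<le> S.cy z" "S.cy z \<le> 1" for z
      using that by (intro f_slopes(3)) auto
    show "2 * k * ?Lx (?hf z) \<le> ?Ly (?hf z)"
      if "S.cx z \<in> {1 - \<eta>..1 + 2 * \<eta>}" "- 1 \<le> S.cy z" "S.cy z \<le> - 1/8" for z
      using that by (intro f_slopes(4)) auto
  qed (use pos in auto)
  show ?thesis
  \<comment> \<open>For \<open>\<theta> = 1\<close> the system is \<open>?hg\<close> and
    \<open>- ?hf\<close>; for \<open>\<theta> = - 1\<close> it is \<open>?hf\<close> and
    \<open>- ?hg\<close>, so the two fields exchange their roles, as do \<open>u\<close> and
    \<open>w\<close>.\<close>
  proof (cases "\<theta> = 1")
    case True
    then show ?thesis using uw by (intro T.chaotic_set_between[OF cont _ _ uw]) auto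
  next
    case False
    then have "\<theta> = - 1" using \<theta> by simp
    then show ?thesis
      using uw by (intro T'.chaotic_set_between[OF cont _ _ uw(2,1)]) auto
  qed
qed

theorem theorem2p1:
  fixes X :: "(real^2) set"
    and f g :: "real^2 \<Rightarrow> real^2"
    and xstar e1 e2 :: "real^2"
    and l1 l2 \<delta> :: real
  assumes "X \<noteq> {}" and "open X"
    and "continuous_on X f" and "continuous_on X g"
    and "\<forall>x\<in>X. f x \<noteq> g x"
    and "generates_flow f X" and "generates_flow g X"
    and "xstar \<in> X" and "f xstar = 0" and "g xstar \<noteq> 0"
    and "f differentiable (at xstar)"
    and "eigenpair (jacobian f (at xstar)) l1 e1"
    and "eigenpair (jacobian f (at xstar)) l2 e2"
    and "\<delta> > 0" and "cball xstar \<delta> \<subseteq> X"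
    and "\<forall>x\<in>cball xstar \<delta>. g x \<noteq> 0"
    and "solutions_unbounded_in g X (cball xstar \<delta>)"
    and "l1 < 0" and "l2 > 0"
    and "(\<exists>\<alpha>. \<alpha> \<noteq> 0 \<and> g xstar = \<alpha> *\<^sub>R e1) \<or> (\<exists>\<beta>. \<beta> \<noteq> 0 \<and> g xstar = \<beta> *\<^sub>R e2)"
  shows "\<exists>V. chaotic_set X (\<lambda>x. {f x, g x}) V"
proof -
  have deriv: "(f has_derivative (\<lambda>v. jacobian f (at xstar) *v v)) (at xstar)"
    using assms(11) by (simp add: jacobian_works)
  \<comment> \<open>Both alternatives for \<open>g xstar\<close> are instances, with the eigenpairs
    interchanged.\<close>
  note saddle = saddle_chaotic_set[OF assms(2,3,4,6,7,8,9,10) deriv]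
  have "l1 * l2 < 0" "l2 * l1 < 0" using assms(18,19) by (auto simp: mult_less_0_iff)
  then show ?thesis
    using assms(20) saddle[OF assms(12,13)] saddle[OF assms(13,12)] by blast
qed

end
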